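(* Let $N\in\{1,2,3\}$, $n=2$, and let $B=(\beta_{ij})_{ij}\in S(2)$ be a symmetric real $2\times2$ matrix such that $\beta_{11},\beta_{22}$ are nonnegative. Then the system $$-\Delta u_i=\sum_{j=1}^2\beta_{ij}u_j^2u_i,\qquad u_1,u_2\ge 0\qquad\text{in }\mathbb{R}^N\qquad(i=1,2)$$ admits a nontrivial solution if and only if $B$ is not strictly copositive, i.e., if and only if at least one of the strict inequalities $$\beta_{11}>0,\quad\beta_{22}>0,\quad\beta_{12}>-\sqrt{\beta_{11}\beta_{22}}$$ is not satisfied.
   Context: $S(2)$ denotes the space of symmetric $2\times 2$ matrices with real coefficients, and $C^2_+=\{c\in\mathbb{R}^2: c_1,c_2\ge 0\}$. A matrix $B=(\beta_{ij})_{ij}\in S(2)$ is strictly copositive if $\sum_{i,j=1}^2\beta_{ij}c_ic_j>0$ for all $c\in C^2_+\setminus\{0\}$. A solution $u=(u_1,u_2)$ of the system (all components nonnegative) is called nontrivial if $u_i\not\equiv 0$ for at least one $i$. *)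

theory Defs
  imports "HOL-Analysis.Analysis"
begin

definition partial_deriv :: "'n::finite \<Rightarrow> (real ^ 'n \<Rightarrow> real) \<Rightarrow> real ^ 'n \<Rightarrow> real" where
  "partial_deriv k f x = frechet_derivative f (at x) (axis k 1)"

definition C1_function :: "(real ^ 'n::finite \<Rightarrow> real) \<Rightarrow> bool" where
  "C1_function f \<longleftrightarrow>
     (\<forall>x. f differentiable (at x)) \<and> (\<forall>k. continuous_on UNIV (partial_deriv k f))"

definition C2_function :: "(real ^ 'n::finite \<Rightarrow> real) \<Rightarrow> bool" where
  "C2_function f \<longleftrightarrow> C1_function f \<and> (\<forall>k. C1_function (partial_deriv k f))"

definition laplacian :: "(real ^ 'n::finite \<Rightarrow> real) \<Rightarrow> real ^ 'n \<Rightarrow> real" where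
  "laplacian f x = (\<Sum>k\<in>UNIV. partial_deriv k (partial_deriv k f) x)"

text \<open>Solutions are understood in the classical sense. The number of components of \<open>u\<close> is
  \<open>CARD('m)\<close> and the dimension of the domain is \<open>CARD('n)\<close>.\<close>

definition nonneg_entire_solution ::
    "real ^ 'm ^ 'm \<Rightarrow> ('m::finite \<Rightarrow> real ^ 'n::finite \<Rightarrow> real) \<Rightarrow> bool" where
  "nonneg_entire_solution B u \<longleftrightarrow>
     (\<forall>i. C2_function (u i) \<and>
          (\<forall>x. u i x \<ge> 0 \<and>
               - laplacian (u i) x = (\<Sum>j\<in>UNIV. B $ i $ j * (u j x)\<^sup>2 * u i x)))"

definition nontrivial :: "('m::finite \<Rightarrow> real ^ 'n::finite \<Rightarrow> real) \<Rightarrow> bool" where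
  "nontrivial u \<longleftrightarrow> (\<exists>i. u i \<noteq> (\<lambda>x. 0))"

definition strictly_copositive :: "real ^ 'm ^ 'm::finite \<Rightarrow> bool" where
  "strictly_copositive B \<longleftrightarrow>
     (\<forall>c :: real ^ 'm. (\<forall>i. c $ i \<ge> 0) \<and> c \<noteq> 0 \<longrightarrow>
        (\<Sum>i\<in>UNIV. \<Sum>j\<in>UNIV. B $ i $ j * c $ i * c $ j) > 0)"

end

theory Submission
  imports Defs "HOL-Real_Asymp.Real_Asymp"
begin

text \<open>
  \<^emph>\<open>Nonexistence.\<close> Let B be strictly copositive and write \<beta>11 = a^4, \<beta>22 = g^4 and
  \<beta>12 = -\<kappa> a^2 g^2, so that \<kappa> < 1. The weights g and a are chosen so that, in terms of
  X = a u1 and Y = g u2, the function w = g u1 + a u2 satisfies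
  -\<Delta>w = a g (X + Y) (X^2 + Y^2 - (1 + \<kappa>) X Y), and the right-hand side is bounded below by a
  positive multiple of w^3 (\<open>weighted_cubic_lower_bound\<close>). This reduces the system to the scalar
  inequality -\<Delta>w \<ge> c w^3 with w \<ge> 0, for which the exponent 3 is exactly critical in dimension 3
  (\<open>superharmonic_cubic_liouville\<close>). The maximum principle suffices there: a nontrivial w lies above
  a multiple of 1/r at infinity, then -\<Delta>w lies above a multiple of 1/r^3, which improves the lower
  bound for w to a multiple of log r / r (\<open>log_decay_comparison\<close>); on the other hand, touching w
  from below by a paraboloid shows that the minimum of w over the sphere of radius r is at most a
  multiple of 1/r (\<open>sphere_minimum_upper_bound\<close>).

  \<^emph>\<open>Existence.\<close> If a diagonal entry vanishes, or if \<beta>12 = -sqrt (\<beta>11 \<beta>22), there are constant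
  solutions. In the remaining case put \<alpha> = \<beta>11, \<gamma> = \<beta>22 and \<beta> = -\<beta>12, so that \<beta>^2 > \<alpha> \<gamma>. There is
  a positive periodic solution that depends on one variable only, that is, a solution of
  u'' = u (\<beta> v^2 - \<alpha> u^2), v'' = v (\<beta> u^2 - \<gamma> v^2). It is found by shooting. Start at rest at
  u = \<sigma>, v = 1, where 0 \<le> \<sigma>^2 \<le> \<gamma>/\<beta>; for \<sigma> in the interior of this range u starts to grow and
  v starts to decay. If \<sigma>^2 = \<gamma>/\<beta>, then v turns around while u is still growing. If \<sigma> = 0, then v
  reaches 0 without turning around, which is counted together with the case that u turns around
  first. These two alternatives exclude each other and both are open in \<sigma>, so by connectedness some
  \<sigma> belongs to neither, and for this \<sigma> both velocities vanish at one and the same time T > 0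
  (\<open>simultaneous_rest\<close>). As the equations are invariant under time reversal, the orbit is symmetric
  about the times 0 and T, and the bounds that it obeys on [0, T] persist for all time
  (\<open>exists_positive_entire_orbit\<close>).
\<close>

section \<open>Comparison principles and the critical Liouville theorem\<close>

lemma second_derivative_nonneg_at_local_min:
  fixes \<phi> \<phi>' :: "real \<Rightarrow> real"
  assumes "e > 0"
    and deriv: "\<And>t. \<bar>t\<bar> < e \<Longrightarrow> (\<phi> has_real_derivative \<phi>' t) (at t)"
    and deriv2: "(\<phi>' has_real_derivative D) (at 0)"
    and min: "\<And>t. \<bar>t\<bar> < e \<Longrightarrow> \<phi> 0 \<le> \<phi> t"
  shows "D \<ge> 0"
proof (rule ccontr)
  assume "\<not> D \<ge> 0"
  then obtain d where "d > 0" and d: "\<And>h. 0 < h \<Longrightarrow> h < d \<Longrightarrow> \<phi>' (0 + h) < \<phi>' 0"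
    using DERIV_neg_dec_right[OF deriv2] by auto
  have "\<phi>' 0 = 0"
    using DERIV_local_min[OF deriv[of 0] \<open>e > 0\<close>] min \<open>e > 0\<close> by auto
  define r where "r = min d e / 2"
  have r: "0 < r" "r < d" "r < e"
    using \<open>d > 0\<close> \<open>e > 0\<close> by (auto simp: r_def min_def)
  have "\<exists>z>0. z < r \<and> \<phi> r - \<phi> 0 = (r - 0) * \<phi>' z"
    using r by (intro MVT2 deriv) auto
  then obtain z where "0 < z" "z < r" and z: "\<phi> r - \<phi> 0 = r * \<phi>' z"
    by auto
  then have "\<phi>' z < 0"
    using d[of z] r \<open>\<phi>' 0 = 0\<close> by auto
  then have "r * \<phi>' z < 0"
    using r by (simp add: mult_pos_neg)
  then show False
    using z min[of r] r by auto
qed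

lemma partial_deriv_along_axis:
  fixes f :: "real ^ 'n::finite \<Rightarrow> real"
  assumes "C1_function f"
  shows "((\<lambda>t. f (y + t *\<^sub>R axis k 1)) has_real_derivative
           partial_deriv k f (y + t *\<^sub>R axis k 1)) (at t)"
proof -
  have "(f has_derivative frechet_derivative f (at (y + t *\<^sub>R axis k 1)))
          (at (y + t *\<^sub>R axis k 1))"
    using assms frechet_derivative_works by (auto simp: C1_function_def)
  then have "(f \<circ> (\<lambda>t. y + t *\<^sub>R axis k 1) has_derivative
      frechet_derivative f (at (y + t *\<^sub>R axis k 1)) \<circ> (\<lambda>t. t *\<^sub>R axis k 1)) (at t)"
    by (intro diff_chain_at) (auto intro!: derivative_eq_intros)
  moreover have "linear (frechet_derivative f (at (y + t *\<^sub>R axis k 1)))"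
    using \<open>(f has_derivative _) _\<close> has_derivative_linear by blast
  then have "frechet_derivative f (at (y + t *\<^sub>R axis k 1)) \<circ> (\<lambda>t. t *\<^sub>R axis k 1)
      = (*) (partial_deriv k f (y + t *\<^sub>R axis k 1))"
    by (auto simp: fun_eq_iff partial_deriv_def linear_scale)
  ultimately show ?thesis
    by (simp add: has_field_derivative_def o_def)
qed

text \<open>
  This is the form in which the maximum principle is used throughout. If F(|x - a|^2) touches w from
  below at y, the difference restricted to each coordinate line has a minimum at y. Adding up the
  second derivatives compares \<Delta>w with 4 s F''(s) + 2 N F'(s), the Laplacian of F(|x - a|^2) at
  s = |y - a|^2. Working with the squared radius keeps square roots out of the derivatives.
\<close>
lemma laplacian_lower_bound_at_radial_contact:
  fixes w :: "real ^ 'n::finite \<Rightarrow> real" and F F' F'' :: "real \<Rightarrow> real"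
  assumes C2: "C2_function w"
    and S: "open S" "(norm (y - a))\<^sup>2 \<in> S"
    and F: "\<And>s. s \<in> S \<Longrightarrow> (F has_real_derivative F' s) (at s)"
    and F': "\<And>s. s \<in> S \<Longrightarrow> (F' has_real_derivative F'' s) (at s)"
    and "e > 0"
    and min: "\<And>x. norm (x - y) < e \<Longrightarrow>
        w y - F ((norm (y - a))\<^sup>2) \<le> w x - F ((norm (x - a))\<^sup>2)"
  shows "4 * (norm (y - a))\<^sup>2 * F'' ((norm (y - a))\<^sup>2)
      + 2 * CARD('n) * F' ((norm (y - a))\<^sup>2) \<le> laplacian w y"
proof -
  define s where "s = (norm (y - a))\<^sup>2"
  have comp: "4 * ((y - a) $ k)\<^sup>2 * F'' s + 2 * F' s \<le> partial_deriv k (partial_deriv k w) y" for k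
  proof -
    define q where "q = (\<lambda>t. s + 2 * t * (y - a) $ k + t\<^sup>2)"
    have q: "(norm (y + t *\<^sub>R axis k 1 - a))\<^sup>2 = q t" for t
    proof -
      have "(norm (y + t *\<^sub>R axis k 1 - a))\<^sup>2 = (norm ((y - a) + t *\<^sub>R axis k 1))\<^sup>2"
        by (simp add: algebra_simps)
      also have "\<dots> = q t"
        unfolding power2_norm_eq_inner q_def s_def
        by (simp add: inner_add inner_axis inner_axis' algebra_simps power2_eq_square)
      finally show ?thesis .
    qed
    have dq: "(q has_real_derivative (2 * (y - a) $ k + 2 * t)) (at t)" for t
      unfolding q_def by (auto intro!: derivative_eq_intros)
    have "q 0 = s" by (simp add: q_def)
    have "continuous (at 0) q"
      using dq DERIV_isCont by blast
    then have "\<forall>\<^sub>F t in at 0. q t \<in> S"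
      using S \<open>q 0 = s\<close> by (intro topological_tendstoD[of q s]) (auto simp: isCont_def s_def)
    then obtain d where "d > 0" and d: "\<And>t. t \<noteq> 0 \<Longrightarrow> \<bar>t\<bar> < d \<Longrightarrow> q t \<in> S"
      by (auto simp: eventually_at dist_real_def)
    define \<phi> where "\<phi> = (\<lambda>t. w (y + t *\<^sub>R axis k 1) - F (q t))"
    define \<phi>' where "\<phi>' = (\<lambda>t. partial_deriv k w (y + t *\<^sub>R axis k 1)
        - F' (q t) * (2 * (y - a) $ k + 2 * t))"
    have qS: "q t \<in> S" if "\<bar>t\<bar> < min d e" for t
      using that d[of t] S \<open>q 0 = s\<close> by (cases "t = 0") (auto simp: s_def)
    have "partial_deriv k (partial_deriv k w) (y + 0 *\<^sub>R axis k 1)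
        - (F'' s * (2 * (y - a) $ k + 2 * 0) * (2 * (y - a) $ k + 2 * 0) + 2 * F' s) \<ge> 0"
    proof (rule second_derivative_nonneg_at_local_min[of "min d e" \<phi> \<phi>'])
      show "min d e > 0" using \<open>d > 0\<close> \<open>e > 0\<close> by auto
      show "(\<phi> has_real_derivative \<phi>' t) (at t)" if "\<bar>t\<bar> < min d e" for t
        unfolding \<phi>_def \<phi>'_def
        using C2 by (intro DERIV_diff partial_deriv_along_axis DERIV_chain2[OF F dq] qS that)
          (auto simp: C2_function_def)
      have "((\<lambda>t. F' (q t) * (2 * (y - a) $ k + 2 * t)) has_real_derivative
          (F'' s * (2 * (y - a) $ k + 2 * 0)) * (2 * (y - a) $ k + 2 * 0) + 2 * F' s) (at 0)"
        using DERIV_chain2[OF F'[of "q 0"] dq[of 0]] S \<open>q 0 = s\<close>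
        by (auto intro!: derivative_eq_intros simp: s_def)
      then show "(\<phi>' has_real_derivative partial_deriv k (partial_deriv k w) (y + 0 *\<^sub>R axis k 1)
        - (F'' s * (2 * (y - a) $ k + 2 * 0) * (2 * (y - a) $ k + 2 * 0) + 2 * F' s)) (at 0)"
        unfolding \<phi>'_def
        using C2 by (intro DERIV_diff partial_deriv_along_axis)
          (auto simp: C2_function_def)
      show "\<phi> 0 \<le> \<phi> t" if "\<bar>t\<bar> < min d e" for t
        using min[of "y + t *\<^sub>R axis k 1"] q[of t] that \<open>q 0 = s\<close> unfolding \<phi>_def
        by (auto simp: s_def)
    qed
    then show ?thesis
      by (simp add: power2_eq_square algebra_simps)
  qed
  have "(\<Sum>k\<in>UNIV. ((y - a) $ k)\<^sup>2) = s"
    unfolding s_def power2_norm_eq_inner inner_vec_def by (simp add: power2_eq_square)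
  then have "4 * s * F'' s + 2 * CARD('n) * F' s
      = (\<Sum>k\<in>UNIV. 4 * ((y - a) $ k)\<^sup>2 * F'' s + 2 * F' s)"
    by (simp add: sum.distrib flip: sum_distrib_left sum_distrib_right)
  also have "\<dots> \<le> laplacian w y"
    unfolding laplacian_def by (intro sum_mono comp)
  finally show ?thesis by (simp add: s_def)
qed

lemma C2_function_continuous_on: "C2_function f \<Longrightarrow> continuous_on S f"
  unfolding C2_function_def C1_function_def
  by (meson differentiable_at_imp_differentiable_on differentiable_imp_continuous_on)

text \<open>
  Since F tends to 0 and w \<ge> 0, a negative value of w - F outside the ball forces w - F to have a
  minimum at finite distance and off the boundary sphere, where the strict differential inequality
  is violated.
\<close>
lemma exterior_comparison:
  fixes w :: "real ^ 'n::finite \<Rightarrow> real" and F F' F'' :: "real \<Rightarrow> real"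
  assumes C2: "C2_function w" and nonneg: "\<And>x. w x \<ge> 0" and "r > 0"
    and F: "\<And>s. s > 0 \<Longrightarrow> (F has_real_derivative F' s) (at s)"
    and F': "\<And>s. s > 0 \<Longrightarrow> (F' has_real_derivative F'' s) (at s)"
    and lim: "(F \<longlongrightarrow> 0) at_top"
    and boundary: "\<And>x. norm (x - a) = r \<Longrightarrow> F (r\<^sup>2) \<le> w x"
    and strict: "\<And>x s. s = (norm (x - a))\<^sup>2 \<Longrightarrow> s > r\<^sup>2 \<Longrightarrow>
        laplacian w x < 4 * s * F'' s + 2 * CARD('n) * F' s"
    and x: "norm (x - a) \<ge> r"
  shows "F ((norm (x - a))\<^sup>2) \<le> w x"
proof (rule ccontr)
  define h where "h = (\<lambda>x. w x - F ((norm (x - a))\<^sup>2))"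
  assume "\<not> ?thesis"
  then have hx: "h x < 0" by (simp add: h_def)
  then have "\<forall>\<^sub>F s in at_top. F s < - h x"
    using lim by (auto intro: order_tendstoD)
  then obtain s1 where s1: "\<And>s. s \<ge> s1 \<Longrightarrow> F s < - h x"
    by (auto simp: eventually_at_top_linorder)
  define R where "R = Max {norm (x - a), 1, s1} + 1"
  have R: "norm (x - a) < R" "1 \<le> R" "s1 \<le> R"
    by (auto simp: R_def)
  have "s1 \<le> R\<^sup>2"
    using R power_increasing[of 1 2 R] by auto
  define K where "K = cball a R - ball a r"
  have cont: "continuous_on K h"
  proof -
    have "continuous_on {0<..} F"
      by (intro continuous_at_imp_continuous_on ballI DERIV_isCont[OF F]) auto
    then have "continuous_on K (\<lambda>x. F ((norm (x - a))\<^sup>2))"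
      by (rule continuous_on_compose2[of _ F])
        (use \<open>r > 0\<close> in \<open>auto intro!: continuous_intros simp: K_def dist_norm norm_minus_commute\<close>)
    then show ?thesis
      unfolding h_def by (rule continuous_on_diff[OF C2_function_continuous_on[OF C2]])
  qed
  have "compact K"
    unfolding K_def by (intro compact_diff) auto
  have "x \<in> K"
    using x R by (auto simp: K_def dist_norm norm_minus_commute)
  obtain y where "y \<in> K" and y: "\<And>z. z \<in> K \<Longrightarrow> h y \<le> h z"
    using continuous_attains_inf[OF \<open>compact K\<close> _ cont] \<open>x \<in> K\<close> by blast
  have "norm (y - a) \<noteq> r"
    using boundary[of y] y[OF \<open>x \<in> K\<close>] hx by (auto simp: h_def)
  moreover have "norm (y - a) \<noteq> R"
    using s1[OF \<open>s1 \<le> R\<^sup>2\<close>] nonneg[of y] y[OF \<open>x \<in> K\<close>] by (auto simp: h_def)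
  ultimately have ya: "r < norm (y - a)" "norm (y - a) < R"
    using \<open>y \<in> K\<close> by (auto simp: K_def dist_norm norm_minus_commute)
  define e where "e = min (norm (y - a) - r) (R - norm (y - a))"
  have "e > 0" using ya by (auto simp: e_def)
  have "z \<in> K" if "norm (z - y) < e" for z
  proof -
    have "norm (z - a) \<le> norm (z - y) + norm (y - a)"
      using norm_triangle_ineq[of "z - y" "y - a"] by simp
    moreover have "norm (y - a) \<le> norm (z - y) + norm (z - a)"
      using norm_triangle_ineq[of "y - z" "z - a"] by (simp add: norm_minus_commute)
    ultimately show ?thesis
      using that by (auto simp: e_def K_def dist_norm norm_minus_commute)
  qed
  then have loc: "w y - F ((norm (y - a))\<^sup>2) \<le> w z - F ((norm (z - a))\<^sup>2)"
    if "norm (z - y) < e" for z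
    using y that by (auto simp: h_def)
  have gt: "r\<^sup>2 < (norm (y - a))\<^sup>2"
    using ya \<open>r > 0\<close> by (intro power_strict_mono) auto
  have "4 * (norm (y - a))\<^sup>2 * F'' ((norm (y - a))\<^sup>2)
      + 2 * CARD('n) * F' ((norm (y - a))\<^sup>2) \<le> laplacian w y"
    using ya \<open>r > 0\<close>
    by (intro laplacian_lower_bound_at_radial_contact[OF C2 open_greaterThan[of 0] _ F F' \<open>e > 0\<close> loc])
      auto
  then show False
    using strict[OF refl gt] by auto
qed

text \<open>
  The paraboloid -\<kappa> |x - a|^2 is moved up until it touches w inside the ball.
\<close>
lemma interior_contact:
  fixes w :: "real ^ 'n::finite \<Rightarrow> real" and \<kappa> :: real
  assumes C2: "C2_function w" and "R > 0"
    and z: "norm (z - a) < R" "\<And>x. norm (x - a) = R \<Longrightarrow> w z + \<kappa> * (norm (z - a))\<^sup>2 < w x + \<kappa> * R\<^sup>2"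
  obtains y where "norm (y - a) < R" "laplacian w y \<ge> - 2 * CARD('n) * \<kappa>"
proof -
  define h where "h = (\<lambda>x. w x + \<kappa> * (norm (x - a))\<^sup>2)"
  have cont: "continuous_on (cball a R) h"
    unfolding h_def by (intro continuous_intros C2_function_continuous_on C2)
  obtain y where "y \<in> cball a R" and y: "\<And>x. x \<in> cball a R \<Longrightarrow> h y \<le> h x"
    using continuous_attains_inf[OF compact_cball _ cont] \<open>R > 0\<close> by fastforce
  have "z \<in> cball a R"
    using z by (auto simp: dist_norm norm_minus_commute)
  then have "norm (y - a) \<noteq> R"
    using z(2)[of y] y[of z] by (auto simp: h_def)
  then have ya: "norm (y - a) < R"
    using \<open>y \<in> cball a R\<close> by (auto simp: dist_norm norm_minus_commute)
  have "w y - (- \<kappa> * (norm (y - a))\<^sup>2) \<le> w x - (- \<kappa> * (norm (x - a))\<^sup>2)"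
    if "norm (x - y) < R - norm (y - a)" for x
    using y[of x] that norm_triangle_ineq[of "x - y" "y - a"]
    by (auto simp: h_def dist_norm norm_minus_commute)
  then have "4 * (norm (y - a))\<^sup>2 * (\<lambda>s. 0) ((norm (y - a))\<^sup>2)
      + 2 * CARD('n) * (\<lambda>s. - \<kappa>) ((norm (y - a))\<^sup>2) \<le> laplacian w y"
    using ya by (intro laplacian_lower_bound_at_radial_contact[OF C2 open_UNIV,
          where F = "\<lambda>s. - \<kappa> * s" and e = "R - norm (y - a)"])
      (auto intro!: derivative_eq_intros)
  then show ?thesis
    using that ya by (auto simp: algebra_simps)
qed

text \<open>
  The Laplacian of r^(-\<alpha>) is \<alpha> (\<alpha> + 2 - N) r^(-\<alpha> - 2). For N \<le> 3 it is positive when \<alpha> > 1, while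
  \<alpha> = 1 is borderline for N = 3 and requires strict superharmonicity of w. Applied with \<alpha> > 1 the
  lemma is a strong minimum principle, and this provides the strictness needed for \<alpha> = 1.
\<close>
lemma decay_comparison:
  fixes w :: "real ^ 'n::finite \<Rightarrow> real"
  assumes dim: "CARD('n) \<le> 3" and C2: "C2_function w" and nonneg: "\<And>x. w x \<ge> 0"
    and "r > 0" "C > 0" "\<alpha> \<ge> 1"
    and boundary: "\<And>x. norm (x - a) = r \<Longrightarrow> C / r powr \<alpha> \<le> w x"
    and super: "\<And>x. laplacian w x \<le> 0"
    and strict: "\<alpha> > 1 \<or> (\<forall>x. laplacian w x < 0)"
    and x: "norm (x - a) \<ge> r"
  shows "C / norm (x - a) powr \<alpha> \<le> w x"
proof -
  define F where "F = (\<lambda>s. C * s powr (- \<alpha> / 2))"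
  define F' where "F' = (\<lambda>s. C * (- \<alpha> / 2) * s powr (- \<alpha> / 2 - 1))"
  define F'' where "F'' = (\<lambda>s. C * (- \<alpha> / 2) * (- \<alpha> / 2 - 1) * s powr (- \<alpha> / 2 - 2))"
  have radial: "F (t\<^sup>2) = C / t powr \<alpha>" if "t > 0" for t
    using that by (simp add: F_def powr_minus divide_simps powr_powr flip: powr_numeral)
  have "F ((norm (x - a))\<^sup>2) \<le> w x"
  proof (rule exterior_comparison[OF C2 nonneg \<open>r > 0\<close>, of F F' F''])
    show "(F has_real_derivative F' s) (at s)" if "s > 0" for s
      unfolding F_def F'_def using that by (auto intro!: derivative_eq_intros)
    show "(F' has_real_derivative F'' s) (at s)" if "s > 0" for s
      unfolding F'_def F''_def using that
      by (auto intro!: derivative_eq_intros simp: field_simps)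
    have "((\<lambda>s. s powr (- \<alpha> / 2)) \<longlongrightarrow> 0) at_top"
      using \<open>\<alpha> \<ge> 1\<close> by (intro tendsto_neg_powr filterlim_ident) auto
    then show "(F \<longlongrightarrow> 0) at_top"
      unfolding F_def using tendsto_mult_right_zero by blast
    show "F (r\<^sup>2) \<le> w x" if "norm (x - a) = r" for x
      using boundary[OF that] radial[OF \<open>r > 0\<close>] by simp
    show "laplacian w x < 4 * s * F'' s + 2 * CARD('n) * F' s" if "s > r\<^sup>2" for x s
    proof -
      have "s > 0" using that by (smt (verit) zero_le_power2)
      have "s * s powr (- \<alpha> / 2 - 2) = s powr (1 + (- \<alpha> / 2 - 2))"
        by (rule powr_mult_base) (use \<open>s > 0\<close> in simp)
      also have "1 + (- \<alpha> / 2 - 2) = - \<alpha> / 2 - 1" by simp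
      finally have "s * s powr (- \<alpha> / 2 - 2) = s powr (- \<alpha> / 2 - 1)" .
      then have "4 * s * F'' s = C * \<alpha> * (\<alpha> + 2) * s powr (- \<alpha> / 2 - 1)"
        unfolding F''_def by (simp add: algebra_simps add_divide_distrib)
      then have eq: "4 * s * F'' s + 2 * CARD('n) * F' s
          = C * \<alpha> * (\<alpha> + 2 - CARD('n)) * s powr (- \<alpha> / 2 - 1)"
        unfolding F'_def by (simp add: algebra_simps)
      have N: "real CARD('n) \<le> 3" using dim by simp
      show ?thesis
      proof (cases "\<alpha> > 1")
        case True
        then have "0 < C * \<alpha> * (\<alpha> + 2 - CARD('n)) * s powr (- \<alpha> / 2 - 1)"
          using \<open>s > 0\<close> \<open>C > 0\<close> N by (intro mult_pos_pos) auto
        then show ?thesis using eq super[of x] by linarith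
      next
        case False
        then have "0 \<le> C * \<alpha> * (\<alpha> + 2 - CARD('n)) * s powr (- \<alpha> / 2 - 1)"
          using \<open>C > 0\<close> N \<open>\<alpha> \<ge> 1\<close> by (intro mult_nonneg_nonneg) auto
        moreover have "laplacian w x < 0" using False strict by auto
        ultimately show ?thesis using eq by linarith
      qed
    qed
  qed (use x in auto)
  moreover have "norm (x - a) > 0" using x \<open>r > 0\<close> by linarith
  ultimately show ?thesis
    using radial[of "norm (x - a)"] by simp
qed


text \<open>
  The Laplacian of 2 A log r / r is -2 A / r^3 in dimension 3; because the function decreases for
  r \<ge> e, the Laplacian is at least that in lower dimensions. The hypothesis on ln (r^2) says r \<ge> e.
\<close>
lemma log_decay_comparison:
  fixes w :: "real ^ 'n::finite \<Rightarrow> real"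
  assumes dim: "CARD('n) \<le> 3" and C2: "C2_function w" and nonneg: "\<And>x. w x \<ge> 0"
    and r: "ln (r\<^sup>2) \<ge> 2" "r > 0" and "A > 0"
    and boundary: "\<And>x. norm (x - a) = r \<Longrightarrow> A * ln (r\<^sup>2) / r \<le> w x"
    and strict: "\<And>x. norm (x - a) > r \<Longrightarrow> laplacian w x < - 2 * A / norm (x - a) ^ 3"
    and x: "norm (x - a) \<ge> r"
  shows "A * ln ((norm (x - a))\<^sup>2) / norm (x - a) \<le> w x"
proof -
  define F where "F = (\<lambda>s. A * ln s * s powr (- 1 / 2))"
  define F' where "F' = (\<lambda>s. A * (1 - ln s / 2) * s powr (- 3 / 2))"
  define F'' where "F'' = (\<lambda>s. A * (3 / 4 * ln s - 2) * s powr (- 5 / 2))"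
  have powr_step: "inverse s * s powr p = s powr (p - 1)" if "s > 0" for s p :: real
    using that by (simp add: powr_diff divide_simps)
  have radial: "F (t\<^sup>2) = A * ln (t\<^sup>2) / t" if "t > 0" for t
    using that by (simp add: F_def powr_minus divide_simps powr_powr flip: powr_numeral)
  have "F ((norm (x - a))\<^sup>2) \<le> w x"
  proof (rule exterior_comparison[OF C2 nonneg \<open>r > 0\<close>, of F F' F''])
    fix s :: real assume "s > 0"
    have "(F has_real_derivative
        A * (inverse s * s powr (- 1 / 2)) + A * ln s * (- 1 / 2 * s powr (- 1 / 2 - 1))) (at s)"
      unfolding F_def using \<open>s > 0\<close> by (auto intro!: derivative_eq_intros simp: divide_simps)
    then show "(F has_real_derivative F' s) (at s)"
      unfolding F'_def powr_step[OF \<open>s > 0\<close>] by (simp add: algebra_simps)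
    have "(F' has_real_derivative
        - A / 2 * (inverse s * s powr (- 3 / 2))
          + A * (1 - ln s / 2) * (- 3 / 2 * s powr (- 3 / 2 - 1))) (at s)"
      unfolding F'_def using \<open>s > 0\<close> by (auto intro!: derivative_eq_intros simp: divide_simps)
    then show "(F' has_real_derivative F'' s) (at s)"
      unfolding F''_def powr_step[OF \<open>s > 0\<close>] by (simp add: field_simps)
  next
    have "((\<lambda>s::real. ln s * s powr (- 1 / 2)) \<longlongrightarrow> 0) at_top"
      by real_asymp
    then show "(F \<longlongrightarrow> 0) at_top"
      unfolding F_def mult.assoc using tendsto_mult_right_zero by blast
  next
    show "F (r\<^sup>2) \<le> w x" if "norm (x - a) = r" for x
      using boundary[OF that] radial[OF \<open>r > 0\<close>] by simp
  next
    fix x :: "real ^ 'n" and s assume s: "s = (norm (x - a))\<^sup>2" "s > r\<^sup>2"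
    then have "s > 0" by (smt (verit) zero_le_power2)
    have far: "norm (x - a) > r"
      using s by (metis norm_ge_zero power2_less_imp_less)
    have "s * s powr (- 5 / 2) = s powr (- 3 / 2)"
      using \<open>s > 0\<close> by (simp add: powr_mult_base)
    moreover have "4 * s * F'' s = A * (3 * ln s - 8) * (s * s powr (- 5 / 2))"
      unfolding F''_def by (simp add: algebra_simps)
    ultimately have "4 * s * F'' s = A * (3 * ln s - 8) * s powr (- 3 / 2)"
      by simp
    then have eq: "4 * s * F'' s + 2 * CARD('n) * F' s
        = A * s powr (- 3 / 2) * ((3 - real CARD('n)) * ln s - 8 + 2 * CARD('n))"
      unfolding F'_def by (simp add: algebra_simps)
    have "ln s \<ge> 2"
      using s r \<open>s > 0\<close> by (smt (verit) ln_mono zero_less_power)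
    then have "(3 - real CARD('n)) * 2 \<le> (3 - real CARD('n)) * ln s"
      using dim by (intro mult_left_mono) auto
    then have "- 2 \<le> (3 - real CARD('n)) * ln s - 8 + 2 * CARD('n)"
      by simp
    then have "A * s powr (- 3 / 2) * (- 2)
        \<le> A * s powr (- 3 / 2) * ((3 - real CARD('n)) * ln s - 8 + 2 * CARD('n))"
      using \<open>A > 0\<close> by (intro mult_left_mono) auto
    moreover have "s powr (- 3 / 2) = 1 / norm (x - a) ^ 3"
      using far \<open>r > 0\<close> unfolding s
      by (simp add: powr_minus divide_simps powr_powr flip: powr_numeral)
    ultimately show "laplacian w x < 4 * s * F'' s + 2 * CARD('n) * F' s"
      using strict[OF far] eq by simp
  qed (use x in auto)
  moreover have "norm (x - a) > 0" using x \<open>r > 0\<close> by linarith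
  ultimately show ?thesis
    using radial[of "norm (x - a)"] by simp
qed

text \<open>
  Let m be the minimum of w over the ball of radius R, which is attained on the sphere. The decay
  rate 1/r gives w \<ge> m/2 on the ball of radius 2 R, while a paraboloid whose height is of order m
  touches w from below in that ball, so that -\<Delta>w \<le> 3 m / R^2 at the contact point. Together,
  c (m/2)^3 \<le> 3 m / R^2.
\<close>
lemma sphere_minimum_upper_bound:
  fixes w :: "real ^ 'n::finite \<Rightarrow> real"
  assumes dim: "CARD('n) \<le> 3" and C2: "C2_function w" and pos: "\<And>x. w x > 0"
    and "c > 0" and super: "\<And>x. c * w x ^ 3 \<le> - laplacian w x" and "R > 0"
  obtains z where "norm (z - a) = R" "c * (w z * R)\<^sup>2 \<le> 24"
proof -
  have neg: "laplacian w x < 0" for x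
    using super[of x] pos[of x] \<open>c > 0\<close> by (smt (verit) mult_pos_pos zero_less_power)
  have "cball a R \<noteq> {}" using \<open>R > 0\<close> by simp
  then obtain z0 where z0: "z0 \<in> cball a R" "\<And>x. x \<in> cball a R \<Longrightarrow> w z0 \<le> w x"
    using continuous_attains_inf[OF compact_cball _ C2_function_continuous_on[OF C2]] by blast
  have "\<exists>z. norm (z - a) = R \<and> w z \<le> w z0"
  proof (rule ccontr)
    assume none: "\<not> ?thesis"
    then have "norm (z0 - a) < R"
      using z0(1) by (force simp: dist_norm norm_minus_commute)
    moreover have "w z0 + 0 * (norm (z0 - a))\<^sup>2 < w x + 0 * R\<^sup>2" if "norm (x - a) = R" for x
      using none that by (auto simp: not_le)
    ultimately obtain y where "laplacian w y \<ge> - 2 * CARD('n) * (0::real)"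
      by (rule interior_contact[OF C2 \<open>R > 0\<close>])
    then show False using neg[of y] by simp
  qed
  then obtain z where z: "norm (z - a) = R" and "w z \<le> w z0" by blast
  then have min: "w z \<le> w x" if "norm (x - a) \<le> R" for x
    using that z0(2)[of x] by (auto simp: dist_norm norm_minus_commute)
  define m where "m = w z"
  have "m > 0" by (simp add: m_def pos)
  have outer: "m * R / norm (x - a) \<le> w x" if "norm (x - a) \<ge> R" for x
    using decay_comparison[OF dim C2 less_imp_le[OF pos] \<open>R > 0\<close>, of "m * R" 1 a x]
      that min neg \<open>m > 0\<close> \<open>R > 0\<close> by (auto simp: m_def less_imp_le)
  \<comment> \<open>Between the radii \<open>R\<close> and \<open>2 * R\<close> the paraboloid drops by 3 m / 2 > m, which keeps the contact point inside.\<close>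
  define \<kappa> where "\<kappa> = m / (2 * R\<^sup>2)"
  obtain y where y: "norm (y - a) < 2 * R" and lap: "laplacian w y \<ge> - 2 * CARD('n) * \<kappa>"
  proof (rule interior_contact[OF C2, of "2 * R" z a \<kappa>])
    show "w z + \<kappa> * (norm (z - a))\<^sup>2 < w x + \<kappa> * (2 * R)\<^sup>2" for x
      using pos[of x] \<open>m > 0\<close> \<open>R > 0\<close> unfolding z by (simp add: \<kappa>_def power_mult_distrib flip: m_def)
  qed (use z \<open>R > 0\<close> in auto)
  have "m / 2 \<le> w y"
  proof (cases "norm (y - a) \<le> R")
    case True
    then show ?thesis using min \<open>m > 0\<close> by (force simp: m_def)
  next
    case False
    have "m / 2 \<le> m * R / norm (y - a)"
      using y False \<open>R > 0\<close> \<open>m > 0\<close> by (subst pos_le_divide_eq) auto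
    also have "\<dots> \<le> w y" using outer[of y] False by simp
    finally show ?thesis .
  qed
  then have "c * (m / 2) ^ 3 \<le> c * w y ^ 3"
    using \<open>c > 0\<close> \<open>m > 0\<close> by (intro mult_left_mono power_mono) auto
  also have "\<dots> \<le> 2 * CARD('n) * \<kappa>"
    using super[of y] lap by simp
  also have "\<dots> \<le> 2 * 3 * \<kappa>"
    using dim \<open>m > 0\<close> by (intro mult_right_mono) (auto simp: \<kappa>_def)
  finally have "(c * (m * R)\<^sup>2) * m \<le> 24 * m"
    using \<open>R > 0\<close> by (simp add: \<kappa>_def field_simps power2_eq_square power3_eq_cube)
  then have "c * (m * R)\<^sup>2 \<le> 24"
    using \<open>m > 0\<close> by simp
  then show ?thesis using that z by (simp add: m_def)
qed

text \<open>
  For a nontrivial w, the lower bound by a multiple of log r / r contradicts the upper bound by a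
  multiple of 1/r for the minimum over large spheres.
\<close>
theorem superharmonic_cubic_liouville:
  fixes w :: "real ^ 'n::finite \<Rightarrow> real"
  assumes dim: "CARD('n) \<le> 3" and C2: "C2_function w" and nonneg: "\<And>x. w x \<ge> 0"
    and "c > 0" and super: "\<And>x. c * w x ^ 3 \<le> - laplacian w x"
  shows "w x = 0"
proof (rule ccontr)
  assume "w x \<noteq> 0"
  define a where "a = x"
  have "w a > 0" using \<open>w x \<noteq> 0\<close> nonneg[of a] by (simp add: a_def)
  have lap_nonpos: "laplacian w x \<le> 0" for x
    using super[of x] nonneg[of x] \<open>c > 0\<close> by (smt (verit) mult_nonneg_nonneg zero_le_power)
  define \<delta> where "\<delta> = w a / 2"
  have "\<delta> > 0" using \<open>w a > 0\<close> by (simp add: \<delta>_def)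
  have "isCont w a"
    using C2_function_continuous_on[OF C2, of UNIV] by (simp add: continuous_on_eq_continuous_at)
  then obtain r0 where "r0 > 0" and r0: "\<And>x. dist x a < r0 \<Longrightarrow> dist (w x) (w a) < \<delta>"
    using \<open>\<delta> > 0\<close> unfolding continuous_at_eps_delta by metis
  define r where "r = r0 / 2"
  have "r > 0" using \<open>r0 > 0\<close> by (simp add: r_def)
  have near: "\<delta> \<le> w x" if "norm (x - a) \<le> r" for x
  proof -
    have "dist (w x) (w a) < \<delta>"
      using r0[of x] that \<open>r0 > 0\<close> by (auto simp: r_def dist_norm)
    then show ?thesis
      unfolding \<delta>_def dist_real_def by linarith
  qed
  \<comment> \<open>Any exponent above 1 would serve here in place of 2.\<close>
  have pos: "w x > 0" for x
  proof (cases "norm (x - a) \<le> r")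
    case True
    then show ?thesis using near \<open>\<delta> > 0\<close> by fastforce
  next
    case False
    then have "\<delta> * r powr 2 / norm (x - a) powr 2 \<le> w x"
      using decay_comparison[OF dim C2 nonneg \<open>r > 0\<close>, of "\<delta> * r powr 2" 2 a x]
        near lap_nonpos \<open>\<delta> > 0\<close> \<open>r > 0\<close> by auto
    moreover have "\<delta> * r powr 2 / norm (x - a) powr 2 > 0"
      using False \<open>r > 0\<close> \<open>\<delta> > 0\<close> by (intro divide_pos_pos mult_pos_pos) auto
    ultimately show ?thesis by linarith
  qed
  have neg: "laplacian w x < 0" for x
    using super[of x] pos[of x] \<open>c > 0\<close> by (smt (verit) mult_pos_pos zero_less_power)
  define c0 where "c0 = \<delta> * r"
  have "c0 > 0" using \<open>\<delta> > 0\<close> \<open>r > 0\<close> by (simp add: c0_def)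
  have first_order: "c0 / norm (x - a) \<le> w x" if "norm (x - a) \<ge> r" for x
    using decay_comparison[OF dim C2 nonneg \<open>r > 0\<close>, of c0 1 a x]
      that near neg \<open>c0 > 0\<close> \<open>r > 0\<close> by (auto simp: c0_def less_imp_le)
  define \<rho> where "\<rho> = max r (exp 1)"
  have \<rho>: "\<rho> \<ge> r" "\<rho> > 0" using \<open>r > 0\<close> by (auto simp: \<rho>_def)
  have "ln (exp 1 :: real) \<le> ln \<rho>"
    by (intro ln_mono) (auto simp: \<rho>_def)
  then have ln\<rho>: "ln (\<rho>\<^sup>2) \<ge> 2"
    using \<open>\<rho> > 0\<close> by (simp add: ln_realpow)
  \<comment> \<open>The first entry makes the Laplacian of \<open>w\<close> smaller than that of the barrier, the second places the barrier below \<open>w\<close> on the sphere of radius \<open>\<rho>\<close>.\<close>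
  define A where "A = min (c * c0 ^ 3 / 4) (c0 / ln (\<rho>\<^sup>2))"
  have "A > 0" using \<open>c > 0\<close> \<open>c0 > 0\<close> ln\<rho> by (simp add: A_def)
  have A: "4 * A \<le> c * c0 ^ 3" "A * ln (\<rho>\<^sup>2) \<le> c0"
    using ln\<rho> by (auto simp: A_def min_def field_simps)
  have log_order: "A * ln ((norm (x - a))\<^sup>2) / norm (x - a) \<le> w x" if "norm (x - a) \<ge> \<rho>" for x
  proof (rule log_decay_comparison[OF dim C2 nonneg ln\<rho> \<open>\<rho> > 0\<close> \<open>A > 0\<close> _ _ that])
    fix x assume "norm (x - a) = \<rho>"
    then show "A * ln (\<rho>\<^sup>2) / \<rho> \<le> w x"
      using first_order[of x] A(2) \<rho> by (smt (verit) divide_right_mono)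
  next
    fix x assume far: "norm (x - a) > \<rho>"
    define t where "t = norm (x - a)"
    have "t > 0" using far \<rho> unfolding t_def by linarith
    have "2 * A / t ^ 3 < 4 * A / t ^ 3"
      using \<open>A > 0\<close> \<open>t > 0\<close> by (intro divide_strict_right_mono) auto
    also have "\<dots> \<le> c * c0 ^ 3 / t ^ 3"
      using A \<open>t > 0\<close> by (intro divide_right_mono) auto
    also have "\<dots> = c * (c0 / t) ^ 3" by (simp add: power_divide)
    also have "\<dots> \<le> c * w x ^ 3"
      using first_order[of x] far \<rho> \<open>c0 > 0\<close> \<open>t > 0\<close> \<open>c > 0\<close>
      by (intro mult_left_mono power_mono) (auto simp: t_def)
    also have "\<dots> \<le> - laplacian w x" by (rule super)
    finally show "laplacian w x < - 2 * A / norm (x - a) ^ 3"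
      by (simp add: t_def)
  qed
  \<comment> \<open>\<open>R\<close> is so large that the logarithmic lower bound exceeds the upper bound for the minimum over its sphere.\<close>
  define q where "q = 24 / (c * A\<^sup>2) + 1"
  have "q \<ge> 1" using \<open>c > 0\<close> by (simp add: q_def)
  define R where "R = max \<rho> (exp q)"
  have R: "R \<ge> \<rho>" "R > 0" using \<rho> by (auto simp: R_def)
  have "ln (exp q) \<le> ln R"
    using R by (intro ln_mono) (auto simp: R_def)
  then have lnR: "q \<le> ln (R\<^sup>2)"
    using R \<open>q \<ge> 1\<close> by (simp add: ln_realpow)
  obtain z where z: "norm (z - a) = R" "c * (w z * R)\<^sup>2 \<le> 24"
    using sphere_minimum_upper_bound[OF dim C2 pos \<open>c > 0\<close> super \<open>R > 0\<close>] by blast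
  have "A * q \<le> A * ln (R\<^sup>2)"
    using lnR \<open>A > 0\<close> by simp
  also have "\<dots> \<le> w z * R"
    using log_order[of z] R z by (simp add: divide_simps)
  finally have "(A * q)\<^sup>2 \<le> (w z * R)\<^sup>2"
    using \<open>A > 0\<close> \<open>q \<ge> 1\<close> by (intro power_mono) auto
  then have "c * (A * q)\<^sup>2 \<le> c * (w z * R)\<^sup>2"
    using \<open>c > 0\<close> by (intro mult_left_mono) auto
  moreover have "24 < c * A\<^sup>2 * q"
    using \<open>c > 0\<close> \<open>A > 0\<close> by (simp add: q_def field_simps)
  moreover have "c * A\<^sup>2 * q \<le> c * A\<^sup>2 * q\<^sup>2"
    using \<open>c > 0\<close> \<open>q \<ge> 1\<close> by (intro mult_left_mono) (auto simp: power2_eq_square)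
  ultimately show False
    using z(2) by (simp add: power_mult_distrib)
qed

section \<open>Globally Lipschitz differential equations\<close>

lemma has_vector_derivative_reflect:
  fixes x :: "real \<Rightarrow> 'a::real_normed_vector"
  assumes "(x has_vector_derivative d) (at (c - s))"
  shows "((\<lambda>s. x (c - s)) has_vector_derivative - d) (at s)"
proof -
  have "((\<lambda>s. c - s) has_vector_derivative - 1) (at s)"
    by (auto intro!: derivative_eq_intros)
  from vector_diff_chain_at[OF this assms] show ?thesis
    by (simp add: o_def)
qed

text \<open>
  With respect to the weight exp (2 L |t|), integration from 0 has norm at most 1 / (2 L).
\<close>
lemma norm_antiderivative_le_exp:
  fixes Q q :: "real \<Rightarrow> 'a::real_normed_vector"
  assumes "L > 0" "K \<ge> 0" "Q 0 = 0"
    and deriv: "\<And>t. (Q has_vector_derivative q t) (at t)"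
    and bound: "\<And>t. norm (q t) \<le> K * exp (2 * L * \<bar>t\<bar>)"
  shows "norm (Q t) \<le> K / (2 * L) * exp (2 * L * \<bar>t\<bar>)"
proof -
  have forward: "norm (R t) \<le> K / (2 * L) * exp (2 * L * t)"
    if "t > 0" "R 0 = 0" and R: "\<And>t. (R has_vector_derivative r t) (at t)"
      and r: "\<And>t. norm (r t) \<le> K * exp (2 * L * \<bar>t\<bar>)" for R r :: "real \<Rightarrow> 'a" and t
  proof -
    define \<phi> where "\<phi> = (\<lambda>s. K / (2 * L) * exp (2 * L * s))"
    have \<phi>: "(\<phi> has_vector_derivative K * exp (2 * L * s)) (at s)" for s
      unfolding \<phi>_def has_real_derivative_iff_has_vector_derivative[symmetric]
      using \<open>L > 0\<close> by (auto intro!: derivative_eq_intros)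
    have "norm (R t - R 0) \<le> \<phi> t - \<phi> 0"
    proof (rule differentiable_bound_general[OF \<open>t > 0\<close> _ _ R \<phi>])
      show "continuous_on {0..t} R"
        by (intro continuous_at_imp_continuous_on ballI has_vector_derivative_continuous[OF R])
      show "continuous_on {0..t} \<phi>"
        by (intro continuous_at_imp_continuous_on ballI has_vector_derivative_continuous[OF \<phi>])
      show "norm (r s) \<le> K * exp (2 * L * s)" if "0 < s" for s
        using r[of s] that by simp
    qed
    moreover have "\<phi> 0 \<ge> 0" using assms by (simp add: \<phi>_def)
    ultimately show ?thesis using that by (simp add: \<phi>_def)
  qed
  consider "t > 0" | "t = 0" | "t < 0" by linarith
  then show ?thesis
  proof cases
    case 1
    then show ?thesis using forward[OF _ \<open>Q 0 = 0\<close> deriv bound] by simp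
  next
    case 2
    then show ?thesis using assms by simp
  next
    case 3
    have "((\<lambda>s. Q (- s)) has_vector_derivative - q (- s)) (at s)" for s
      using has_vector_derivative_reflect[of Q "q (- s)" 0 s] deriv by simp
    then show ?thesis
      using forward[of "- t" "\<lambda>s. Q (- s)" "\<lambda>s. - q (- s)"] bound[of "- _"] 3 \<open>Q 0 = 0\<close> by auto
  qed
qed

text \<open>
  Picard iteration on the whole line at once: with y(t) = exp (2 L |t|) z(t) and z bounded and
  continuous, the integral operator is a contraction with factor 1/2, so that no continuation of
  local solutions is necessary.
\<close>
theorem lipschitz_ode_global_solution:
  fixes f :: "'a::euclidean_space \<Rightarrow> 'a"
  assumes "L > 0" and lip: "\<And>x y. norm (f x - f y) \<le> L * norm (x - y)"
  shows "\<exists>y. y 0 = y0 \<and> (\<forall>t. (y has_vector_derivative f (y t)) (at t))"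
proof -
  define E where "E = (\<lambda>t. exp (2 * L * \<bar>t\<bar>))"
  have E: "E t > 0" "E t \<ge> 1" for t
    using \<open>L > 0\<close> by (auto simp: E_def)
  have contE: "continuous_on S E" for S
    unfolding E_def by (intro continuous_intros)
  have "L-lipschitz_on UNIV f"
    using \<open>L > 0\<close> lip by (intro lipschitz_onI) (auto simp: dist_norm)
  then have contf: "continuous_on UNIV f"
    by (rule lipschitz_on_continuous_on)
  define g where "g = (\<lambda>(z :: real \<Rightarrow>\<^sub>C 'a) t. f (E t *\<^sub>R z t))"
  have contg: "isCont (g z) t" for z t
  proof -
    have "continuous_on UNIV (\<lambda>t. f (E t *\<^sub>R z t))"
      by (rule continuous_on_compose2[OF contf]) (auto intro!: continuous_intros contE)
    then show ?thesis by (simp add: g_def continuous_on_eq_continuous_at)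
  qed
  have "\<exists>P. P 0 = 0 \<and> (\<forall>t. (P has_vector_derivative g z t) (at t))" for z
  proof -
    obtain P where P: "\<And>t. (P has_vector_derivative g z t) (at t)"
      using einterval_antiderivative[of "-\<infinity>" \<infinity> "g z"] contg by auto
    then have "((\<lambda>t. P t - P 0) has_vector_derivative g z t) (at t)" for t
      by (auto intro!: derivative_eq_intros)
    then show ?thesis by (intro exI[of _ "\<lambda>t. P t - P 0"]) auto
  qed
  then obtain P where P0: "\<And>z. P z 0 = 0"
    and P: "\<And>z t. (P z has_vector_derivative g z t) (at t)"
    by metis
  have contP: "continuous_on S (P z)" for S z
    by (intro continuous_at_imp_continuous_on ballI has_vector_derivative_continuous[OF P])
  have bcont: "(\<lambda>t. (1 / E t) *\<^sub>R (y0 + P z t)) \<in> bcontfun" for z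
  proof (rule bcontfun_normI)
    show "continuous_on UNIV (\<lambda>t. (1 / E t) *\<^sub>R (y0 + P z t))"
      using E(1) by (intro continuous_intros contP contE) (auto simp: less_imp_neq[symmetric])
    define K where "K = norm (f 0) + L * norm z"
    have "K \<ge> 0" using \<open>L > 0\<close> by (simp add: K_def)
    have "norm (g z t) \<le> K * E t" for t
    proof -
      have "norm (g z t) \<le> norm (f 0) + norm (g z t - f 0)"
        by (metis norm_triangle_sub add.commute)
      also have "norm (g z t - f 0) \<le> L * (E t * norm (z t))"
        using lip[of "E t *\<^sub>R z t" 0] E(1)[of t] by (simp add: g_def abs_of_pos)
      also have "\<dots> \<le> L * (E t * norm z)"
        using \<open>L > 0\<close> E(1)[of t] norm_bounded[of z t] by (intro mult_left_mono) auto
      also have "norm (f 0) \<le> norm (f 0) * E t"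
        using E(2)[of t] by (simp add: mult_le_cancel_left1)
      finally show ?thesis by (simp add: K_def algebra_simps)
    qed
    then have "norm (P z t) \<le> K / (2 * L) * E t" for t
      unfolding E_def by (intro norm_antiderivative_le_exp[OF \<open>L > 0\<close> \<open>K \<ge> 0\<close> P0 P])
    then show "norm ((1 / E t) *\<^sub>R (y0 + P z t)) \<le> norm y0 + K / (2 * L)" for t
    proof -
      have "norm (y0 + P z t) \<le> norm y0 * E t + K / (2 * L) * E t"
        using \<open>norm (P z t) \<le> _\<close> E(2)[of t] norm_triangle_ineq[of y0 "P z t"]
        by (smt (verit) mult_le_cancel_left1 norm_ge_zero)
      then have "norm (y0 + P z t) / E t \<le> norm y0 + K / (2 * L)"
        using E(1)[of t] by (simp add: divide_le_eq algebra_simps)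
      moreover have "norm ((1 / E t) *\<^sub>R x) = norm x / E t" for x :: 'a
        using E(1)[of t] by simp
      ultimately show ?thesis by metis
    qed
  qed
  define T where "T = (\<lambda>z. Bcontfun (\<lambda>t. (1 / E t) *\<^sub>R (y0 + P z t)))"
  have T: "T z t = (1 / E t) *\<^sub>R (y0 + P z t)" for z t
    unfolding T_def by (simp add: Bcontfun_inverse[OF bcont])
  have "dist (T z) (T z') \<le> 1 / 2 * dist z z'" for z z'
  proof (rule dist_bound)
    fix t
    have "norm (P z t - P z' t) \<le> (L * dist z z') / (2 * L) * E t"
      unfolding E_def
    proof (rule norm_antiderivative_le_exp[OF \<open>L > 0\<close>])
      show "((\<lambda>t. P z t - P z' t) has_vector_derivative g z t - g z' t) (at t)" for t
        by (intro has_vector_derivative_diff P)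
      show "norm (g z t - g z' t) \<le> L * dist z z' * exp (2 * L * \<bar>t\<bar>)" for t
      proof -
        have "norm (g z t - g z' t) \<le> L * norm (E t *\<^sub>R (z t - z' t))"
          using lip[of "E t *\<^sub>R z t" "E t *\<^sub>R z' t"] by (simp add: g_def scaleR_diff_right)
        also have "\<dots> = L * (dist (z t) (z' t) * E t)"
          using E(1)[of t] by (simp add: dist_norm)
        also have "\<dots> \<le> L * (dist z z' * E t)"
          using \<open>L > 0\<close> E(1)[of t] dist_bounded[of z t z']
          by (intro mult_left_mono mult_right_mono) auto
        finally show ?thesis by (simp add: E_def)
      qed
    qed (use \<open>L > 0\<close> P0 in auto)
    then have "norm (P z t - P z' t) \<le> (1 / 2 * dist z z') * E t"
      using \<open>L > 0\<close> by simp
    moreover have "dist (T z t) (T z' t) = norm (P z t - P z' t) / E t"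
      using E(1)[of t] unfolding T dist_norm by (simp flip: scaleR_diff_right)
    ultimately show "dist (T z t) (T z' t) \<le> 1 / 2 * dist z z'"
      using E(1)[of t] by (simp add: pos_divide_le_eq)
  qed
  then obtain z where z: "T z = z"
    using banach_fix_type[of "1 / 2" T] by auto
  define y where "y = (\<lambda>t. y0 + P z t)"
  have "E t *\<^sub>R z t = y t" for t
    using T[of z t] E(1)[of t] unfolding z y_def by simp
  then have "g z t = f (y t)" for t by (simp add: g_def)
  then have "(y has_vector_derivative f (y t)) (at t)" for t
    using P[of z t] unfolding y_def by (auto intro!: derivative_eq_intros)
  moreover have "y 0 = y0" by (simp add: y_def P0)
  ultimately show ?thesis by blast
qed

text \<open>
  The function exp (-2 L t) |y - z|^2 is nonincreasing for t \<ge> 0; negative times follow by reversing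
  time. When y and z agree at time 0, this is uniqueness.
\<close>
theorem lipschitz_ode_dependence:
  fixes f :: "'a::euclidean_space \<Rightarrow> 'a"
  assumes lip: "\<And>x y. norm (f x - f y) \<le> L * norm (x - y)"
    and y: "\<And>t. (y has_vector_derivative f (y t)) (at t)"
    and z: "\<And>t. (z has_vector_derivative f (z t)) (at t)"
  shows "norm (y t - z t) \<le> exp (L * \<bar>t\<bar>) * norm (y 0 - z 0)"
proof -
  have forward: "norm (y t - z t) \<le> exp (L * t) * norm (y 0 - z 0)"
    if "t \<ge> 0" and lip: "\<And>x y. norm (f x - f y) \<le> L * norm (x - y)"
      and y: "\<And>t. (y has_vector_derivative f (y t)) (at t)"
      and z: "\<And>t. (z has_vector_derivative f (z t)) (at t)" for f :: "'a \<Rightarrow> 'a" and y z t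
  proof -
    define h where "h = (\<lambda>t. exp (- 2 * L * t) * ((y t - z t) \<bullet> (y t - z t)))"
    define h' where "h' = (\<lambda>t. 2 * exp (- 2 * L * t) *
      ((y t - z t) \<bullet> (f (y t) - f (z t)) - L * ((y t - z t) \<bullet> (y t - z t))))"
    have h: "(h has_real_derivative h' t) (at t)" for t
    proof -
      have d: "((\<lambda>t. y t - z t) has_derivative (\<lambda>s. s *\<^sub>R (f (y t) - f (z t)))) (at t)"
        using has_vector_derivative_diff[OF y[of t] z[of t]]
        by (simp add: has_vector_derivative_def)
      have q: "((\<lambda>t. (y t - z t) \<bullet> (y t - z t)) has_real_derivative
          2 * ((y t - z t) \<bullet> (f (y t) - f (z t)))) (at t)"
        unfolding has_field_derivative_def
        by (rule has_derivative_eq_rhs[OF has_derivative_inner[OF d d]])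
          (simp add: inner_commute algebra_simps fun_eq_iff)
      have e: "((\<lambda>t. exp (- 2 * L * t)) has_real_derivative - 2 * L * exp (- 2 * L * t)) (at t)"
        by (auto intro!: derivative_eq_intros)
      show ?thesis
        unfolding h_def h'_def
        by (rule DERIV_cong[OF DERIV_mult[OF e q]]) (simp add: algebra_simps)
    qed
    have "h' t \<le> 0" for t
    proof -
      have "(y t - z t) \<bullet> (f (y t) - f (z t)) \<le> norm (y t - z t) * norm (f (y t) - f (z t))"
        by (rule norm_cauchy_schwarz)
      also have "\<dots> \<le> norm (y t - z t) * (L * norm (y t - z t))"
        by (intro mult_left_mono lip) auto
      also have "\<dots> = L * ((y t - z t) \<bullet> (y t - z t))"
        by (simp add: power2_norm_eq_inner[symmetric] power2_eq_square)
      finally show ?thesis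
        unfolding h'_def by (intro mult_nonneg_nonpos) auto
    qed
    then have "h t \<le> h 0"
      using h by (intro DERIV_nonpos_imp_nonincreasing[OF \<open>t \<ge> 0\<close>]) blast
    then have "(norm (y t - z t))\<^sup>2 \<le> exp (2 * L * t) * (norm (y 0 - z 0))\<^sup>2"
      by (simp add: h_def power2_norm_eq_inner exp_minus field_simps)
    also have "\<dots> = (exp (L * t) * norm (y 0 - z 0))\<^sup>2"
      by (simp add: power_mult_distrib flip: exp_double)
    finally show ?thesis
      by (rule power2_le_imp_le) simp
  qed
  show ?thesis
  proof (cases "t \<ge> 0")
    case True
    then show ?thesis using forward[OF _ lip y z] by simp
  next
    case False
    have rev: "((\<lambda>s. x (- s)) has_vector_derivative - f (x (- s))) (at s)"
      if "\<And>t. (x has_vector_derivative f (x t)) (at t)" for x :: "real \<Rightarrow> 'a" and s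
      using has_vector_derivative_reflect[of x "f (x (- s))" 0 s] that by simp
    have "norm (- f x - - f y) \<le> L * norm (x - y)" for x y
      using lip[of x y] by (simp add: norm_minus_commute)
    then show ?thesis
      using forward[of "- t" "\<lambda>x. - f x" "\<lambda>s. y (- s)" "\<lambda>s. z (- s)"] rev y z False by simp
  qed
qed

text \<open>
  The piece of trajectory up to the hitting time is compact, so nearby trajectories stay in V and hit
  W as well.
\<close>
lemma open_hit_before_exit:
  fixes Y :: "real \<Rightarrow> real \<Rightarrow> 'a::euclidean_space"
  assumes cont: "\<And>\<sigma>. continuous_on UNIV (Y \<sigma>)"
    and dep: "\<And>\<sigma> \<sigma>' t. norm (Y \<sigma> t - Y \<sigma>' t) \<le> exp (L * \<bar>t\<bar>) * \<bar>\<sigma> - \<sigma>'\<bar>" and "L > 0"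
    and "open W" "open V"
  shows "open {\<sigma>. \<exists>t\<ge>0. Y \<sigma> t \<in> W \<and> (\<forall>\<tau>\<in>{0..t}. Y \<sigma> \<tau> \<in> V)}"
proof (unfold open_dist, intro ballI)
  fix \<sigma> assume "\<sigma> \<in> {\<sigma>. \<exists>t\<ge>0. Y \<sigma> t \<in> W \<and> (\<forall>\<tau>\<in>{0..t}. Y \<sigma> \<tau> \<in> V)}"
  then obtain t where t: "t \<ge> 0" "Y \<sigma> t \<in> W" "\<And>\<tau>. 0 \<le> \<tau> \<Longrightarrow> \<tau> \<le> t \<Longrightarrow> Y \<sigma> \<tau> \<in> V"
    by auto
  obtain e1 where e1: "e1 > 0" "\<And>y. dist y (Y \<sigma> t) < e1 \<Longrightarrow> y \<in> W"
    using \<open>open W\<close> t(2) unfolding open_dist by blast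
  define K where "K = Y \<sigma> ` {0..t}"
  have "compact K"
    unfolding K_def using cont by (intro compact_continuous_image) (auto intro: continuous_on_subset)
  moreover have "K \<noteq> {}" "K \<subseteq> V" using t by (auto simp: K_def)
  ultimately obtain e2 where e2: "e2 > 0" "{x. infdist x K \<le> e2} \<subseteq> V"
    using compact_in_open_separated[of K V] \<open>open V\<close> by metis
  define d where "d = min e1 e2 / exp (L * t)"
  have "d > 0" using e1 e2 by (simp add: d_def)
  moreover have "\<sigma>' \<in> {\<sigma>. \<exists>t\<ge>0. Y \<sigma> t \<in> W \<and> (\<forall>\<tau>\<in>{0..t}. Y \<sigma> \<tau> \<in> V)}" if "dist \<sigma>' \<sigma> < d" for \<sigma>'
  proof -
    have close: "dist (Y \<sigma>' \<tau>) (Y \<sigma> \<tau>) < min e1 e2" if "0 \<le> \<tau>" "\<tau> \<le> t" for \<tau>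
    proof -
      have "dist (Y \<sigma>' \<tau>) (Y \<sigma> \<tau>) \<le> exp (L * \<tau>) * \<bar>\<sigma>' - \<sigma>\<bar>"
        using dep[of \<sigma>' \<tau> \<sigma>] that by (simp add: dist_norm)
      also have "\<dots> \<le> exp (L * t) * \<bar>\<sigma>' - \<sigma>\<bar>"
        using that \<open>L > 0\<close> by (intro mult_right_mono) auto
      also have "\<dots> < min e1 e2"
        using \<open>dist \<sigma>' \<sigma> < d\<close> by (simp add: d_def dist_real_def field_simps)
      finally show ?thesis .
    qed
    have "Y \<sigma>' \<tau> \<in> V" if "0 \<le> \<tau>" "\<tau> \<le> t" for \<tau>
    proof -
      have "infdist (Y \<sigma>' \<tau>) K \<le> dist (Y \<sigma>' \<tau>) (Y \<sigma> \<tau>)"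
        using that by (intro infdist_le) (auto simp: K_def)
      then show ?thesis using close[OF that] e2(2) by fastforce
    qed
    moreover have "Y \<sigma>' t \<in> W" using close[of t] e1(2) t(1) by simp
    ultimately show ?thesis using t(1) by auto
  qed
  ultimately show "\<exists>e>0. \<forall>y. dist y \<sigma> < e \<longrightarrow> y \<in> {\<sigma>. \<exists>t\<ge>0. Y \<sigma> t \<in> W \<and> (\<forall>\<tau>\<in>{0..t}. Y \<sigma> \<tau> \<in> V)}"
    by blast
qed

section \<open>Functions of one real variable\<close>

lemma first_zero:
  fixes g :: "real \<Rightarrow> real"
  assumes cont: "continuous_on {a..b} g" and "a \<le> b" "g a > 0" "g b \<le> 0"
  obtains c where "a < c" "c \<le> b" "g c = 0" "\<And>x. a \<le> x \<Longrightarrow> x < c \<Longrightarrow> g x > 0"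
proof -
  define Z where "Z = {x \<in> {a..b}. g x \<le> 0}"
  have "closed Z"
    unfolding Z_def by (intro continuous_on_closed_Collect_le cont continuous_intros)
  moreover have "Z \<subseteq> {a..b}" by (auto simp: Z_def)
  ultimately have "compact Z"
    by (meson bounded_closed_interval bounded_subset compact_eq_bounded_closed)
  moreover have "b \<in> Z" using assms by (auto simp: Z_def)
  ultimately obtain c where "c \<in> Z" and c: "\<And>x. x \<in> Z \<Longrightarrow> c \<le> x"
    using compact_attains_inf[of Z] by blast
  have c_le: "a \<le> c" "c \<le> b" "g c \<le> 0" using \<open>c \<in> Z\<close> by (auto simp: Z_def)
  have before: "g x > 0" if "a \<le> x" "x < c" for x
    using c[of x] that c_le by (force simp: Z_def)
  have "continuous_on {a..c} g"
    using cont by (rule continuous_on_subset) (use c_le in auto)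
  then obtain d where "a \<le> d" "d \<le> c" "g d = 0"
    using IVT2'[of g c 0 a] c_le \<open>g a > 0\<close> by auto
  then have "d = c" using before[of d] by fastforce
  then show ?thesis
    using that[of c] before c_le \<open>g a > 0\<close> \<open>g d = 0\<close> by (cases "a = c") auto
qed

text \<open>
  The hypothesis describes growth from an initial value 0 by an open condition on a closed
  interval: at time 0 the condition g > 0 alone may fail.
\<close>
lemma positive_after_of_derivative_positive_where_nonpositive:
  fixes g g' :: "real \<Rightarrow> real"
  assumes deriv: "\<And>t. (g has_real_derivative g' t) (at t)"
    and "g 0 \<ge> 0"
    and pos: "\<And>\<tau>. 0 \<le> \<tau> \<Longrightarrow> \<tau> \<le> t \<Longrightarrow> g \<tau> > 0 \<or> g' \<tau> > 0"
    and s: "0 < s" "s \<le> t"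
  shows "g s > 0"
proof (rule ccontr)
  assume "\<not> g s > 0"
  have cont: "continuous_on S g" for S
    using deriv by (meson DERIV_isCont continuous_at_imp_continuous_on)
  have "\<exists>a>0. a < s \<and> g a > 0"
  proof (cases "g 0 > 0")
    case True
    have "isCont g 0" using deriv DERIV_isCont by blast
    then obtain d where "d > 0" "\<And>x. dist x 0 < d \<Longrightarrow> dist (g x) (g 0) < g 0"
      using True unfolding continuous_at_eps_delta by blast
    then have "g (min d s / 2) > 0"
      using s by (smt (verit) dist_real_def field_sum_of_halves)
    then show ?thesis using \<open>d > 0\<close> s by (intro exI[of _ "min d s / 2"]) auto
  next
    case False
    then have "g 0 = 0" "g' 0 > 0" using \<open>g 0 \<ge> 0\<close> pos[of 0] s by auto
    then obtain d where "d > 0" "\<And>h. 0 < h \<Longrightarrow> h < d \<Longrightarrow> g 0 < g (0 + h)"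
      using DERIV_pos_inc_right[OF deriv] by blast
    then show ?thesis
      using s \<open>g 0 = 0\<close> by (intro exI[of _ "min d s / 2"]) auto
  qed
  then obtain a where a: "0 < a" "a < s" "g a > 0" by blast
  obtain c where c: "a < c" "c \<le> s" "g c = 0" "\<And>x. a \<le> x \<Longrightarrow> x < c \<Longrightarrow> g x > 0"
    using first_zero[OF cont, of a s] a \<open>\<not> g s > 0\<close> by auto
  have "g' c > 0" using pos[of c] a c s by auto
  then obtain d where d: "d > 0" "\<And>h. 0 < h \<Longrightarrow> h < d \<Longrightarrow> g (c - h) < g c"
    using DERIV_pos_inc_left[OF deriv] by blast
  define h where "h = min d (c - a) / 2"
  have "0 < h" "h < d" "h < c - a" using d(1) c(1) by (auto simp: h_def min_def)
  then show False using d(2)[of h] c(3) c(4)[of "c - h"] by auto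
qed

lemma increasing_bounded_converges:
  fixes g :: "real \<Rightarrow> real"
  assumes mono: "\<And>s t. 0 \<le> s \<Longrightarrow> s \<le> t \<Longrightarrow> g s \<le> g t"
    and bound: "\<And>t. 0 \<le> t \<Longrightarrow> g t \<le> B"
  obtains l where "(g \<longlongrightarrow> l) at_top" "g 0 \<le> l"
proof -
  define l where "l = (SUP t\<in>{0..}. g t)"
  have bdd: "bdd_above (g ` {0..})"
    using bound by (intro bdd_aboveI[of _ B]) auto
  have le: "g t \<le> l" if "0 \<le> t" for t
    unfolding l_def using that by (intro cSUP_upper bdd) auto
  have "(g \<longlongrightarrow> l) at_top"
  proof (rule order_tendstoI)
    fix b assume "b < l"
    then obtain s where "s \<ge> 0" "b < g s"
      unfolding l_def using less_cSUP_iff[OF _ bdd] by auto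
    then show "\<forall>\<^sub>F t in at_top. b < g t"
      using mono unfolding eventually_at_top_linorder by (meson order_less_le_trans)
  next
    fix b assume "l < b"
    then show "\<forall>\<^sub>F t in at_top. g t < b"
      using le unfolding eventually_at_top_linorder by (meson order_le_less_trans)
  qed
  then show ?thesis using that le by simp
qed

text \<open>
  A second derivative with a nonzero limit makes the function grow quadratically. The lemma
  identifies the limits of trajectories that converge.
\<close>
lemma bounded_second_derivative_limit_zero:
  fixes g g' g'' :: "real \<Rightarrow> real"
  assumes g: "\<And>t. (g has_real_derivative g' t) (at t)"
    and g': "\<And>t. (g' has_real_derivative g'' t) (at t)"
    and lim: "(g'' \<longlongrightarrow> l) at_top"
    and bound: "\<And>t. 0 \<le> t \<Longrightarrow> \<bar>g t\<bar> \<le> B"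
  shows "l = 0"
proof -
  have not_pos: "\<not> l > 0"
    if g: "\<And>t. (g has_real_derivative g' t) (at t)"
      and g': "\<And>t. (g' has_real_derivative g'' t) (at t)"
      and lim: "(g'' \<longlongrightarrow> l) at_top"
      and bound: "\<And>t. 0 \<le> t \<Longrightarrow> \<bar>g t\<bar> \<le> B" for g g' g'' :: "real \<Rightarrow> real" and l
  proof
    assume "l > 0"
    have growth: "h x \<ge> h a + m * (x - a)"
      if h: "\<And>t. (h has_real_derivative h' t) (at t)" and "\<And>t. a \<le> t \<Longrightarrow> h' t \<ge> m" "a \<le> x"
      for h h' :: "real \<Rightarrow> real" and a m x
    proof -
      have "h a - m * a \<le> h x - m * x"
      proof (rule DERIV_nonneg_imp_nondecreasing[OF \<open>a \<le> x\<close>])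
        show "\<exists>y. ((\<lambda>x. h x - m * x) has_real_derivative y) (at t) \<and> 0 \<le> y" if "a \<le> t" for t
          using that \<open>\<And>t. a \<le> t \<Longrightarrow> h' t \<ge> m\<close>
          by (intro exI[of _ "h' t - m"]) (auto intro!: derivative_eq_intros h)
      qed
      then show ?thesis by (simp add: algebra_simps)
    qed
    have "\<forall>\<^sub>F t in at_top. g'' t > l / 2"
      using lim \<open>l > 0\<close> by (intro order_tendstoD) auto
    then obtain a where a: "\<And>t. t \<ge> a \<Longrightarrow> g'' t \<ge> l / 2"
      unfolding eventually_at_top_linorder by (meson less_imp_le)
    define b where "b = Max {0, a, a + 2 * (1 - g' a) / l}"
    have b: "0 \<le> b" "a \<le> b" "a + 2 * (1 - g' a) / l \<le> b" by (auto simp: b_def)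
    have "g' t \<ge> 1" if "b \<le> t" for t
    proof -
      have "1 - g' a \<le> l / 2 * (t - a)"
      proof -
        have "2 * (1 - g' a) / l \<le> t - a" using b(3) that by linarith
        then show ?thesis using \<open>l > 0\<close> by (simp add: field_simps)
      qed
      then show ?thesis
        using growth[where a = a and m = "l / 2" and x = t, OF g' a] that b by simp
    qed
    then have "g (b + (2 * B + 1)) \<ge> g b + (2 * B + 1)"
      using growth[OF g, where a = b and m = 1 and x = "b + (2 * B + 1)"] bound[OF b(1)] by simp
    then show False
      using bound[OF b(1)] bound[of "b + (2 * B + 1)"] b(1) by linarith
  qed
  have "\<not> - l > 0"
    by (rule not_pos[of "\<lambda>t. - g t" "\<lambda>t. - g' t" "\<lambda>t. - g'' t"])
      (use bound in \<open>auto intro!: derivative_intros tendsto_minus g g' lim\<close>)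
  then show ?thesis using not_pos[OF g g' lim bound] by simp
qed

text \<open>
  Because (v' - k v) exp (k t) is nonincreasing. The conclusion shows that v cannot arrive at 0 with
  velocity 0.
\<close>
lemma derivative_below_exponential_rate:
  fixes v q a :: "real \<Rightarrow> real"
  assumes v: "\<And>t. (v has_real_derivative q t) (at t)"
    and q: "\<And>t. (q has_real_derivative a t) (at t)"
    and bound: "\<And>t. 0 \<le> t \<Longrightarrow> t \<le> T \<Longrightarrow> a t \<le> k\<^sup>2 * v t"
    and "q 0 < k * v 0" "0 \<le> T"
  shows "q T < k * v T"
proof -
  have "(q T - k * v T) * exp (k * T) \<le> (q 0 - k * v 0) * exp (k * 0)"
  proof (rule DERIV_nonpos_imp_nonincreasing[OF \<open>0 \<le> T\<close>])
    fix t assume t: "0 \<le> t" "t \<le> T"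
    have "((\<lambda>t. (q t - k * v t) * exp (k * t)) has_real_derivative
        (a t - k\<^sup>2 * v t) * exp (k * t)) (at t)"
      by (auto intro!: derivative_eq_intros v q simp: algebra_simps power2_eq_square)
    moreover have "(a t - k\<^sup>2 * v t) * exp (k * t) \<le> 0"
      using bound[OF t] by (intro mult_nonpos_nonneg) auto
    ultimately show "\<exists>y. ((\<lambda>t. (q t - k * v t) * exp (k * t)) has_real_derivative y) (at t) \<and> y \<le> 0"
      by blast
  qed
  also have "\<dots> < 0" using assms by simp
  finally show ?thesis by (simp add: mult_less_0_iff)
qed


lemma isCont_positive_near:
  fixes f :: "real \<Rightarrow> real"
  assumes "isCont f x" "f x > 0"
  obtains e where "e > 0" "\<And>t. \<bar>t - x\<bar> < e \<Longrightarrow> f t > 0"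
proof -
  obtain e where "e > 0" and e: "\<And>t. dist t x < e \<Longrightarrow> dist (f t) (f x) < f x"
    using assms unfolding continuous_at_eps_delta by blast
  have "f t > 0" if "\<bar>t - x\<bar> < e" for t
    using e[of t] that unfolding dist_real_def by linarith
  then show ?thesis using that \<open>e > 0\<close> by blast
qed

section \<open>The truncated competition system\<close>

locale competition =
  fixes \<alpha> \<beta> \<gamma> :: real
  assumes pos: "0 < \<alpha>" "0 < \<beta>" "0 < \<gamma>" and strong: "\<alpha> * \<gamma> < \<beta>\<^sup>2"
begin

text \<open>
  The nonlinearity is made globally Lipschitz by truncating both components to [0, M]. The properties of
  M that matter are M \<ge> 1 and \<alpha> M^2 > 2 \<beta>. As a consequence of the cut at 0, v moves with constant
  velocity while it is negative.
\<close>
definition M :: real where "M = 1 + 2 * \<beta> / \<alpha>"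

definition clamp :: "real \<Rightarrow> real" where "clamp x = max 0 (min M x)"

definition force :: "real \<Rightarrow> real \<Rightarrow> real \<Rightarrow> real" where
  "force d x y = clamp x * (\<beta> * (clamp y)\<^sup>2 - d * (clamp x)\<^sup>2)"

definition field :: "real \<times> real \<times> real \<times> real \<Rightarrow> real \<times> real \<times> real \<times> real" where
  "field = (\<lambda>(u, v, p, q). (p, q, force \<alpha> u v, force \<gamma> v u))"

lemma M_ge_1: "M \<ge> 1" using pos by (simp add: M_def)

lemma M_sq: "\<alpha> * M\<^sup>2 > 2 * \<beta>"
proof -
  have "2 * \<beta> = \<alpha> * (2 * \<beta> / \<alpha>)" using pos by simp
  also have "\<dots> < \<alpha> * M" unfolding M_def using pos by (intro mult_strict_left_mono) auto
  also have "\<dots> \<le> \<alpha> * M\<^sup>2"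
    using M_ge_1 pos by (intro mult_left_mono) (auto simp: power2_eq_square)
  finally show ?thesis .
qed

lemma clamp_range: "0 \<le> clamp x" "clamp x \<le> M"
  using M_ge_1 by (auto simp: clamp_def)

lemma clamp_id: "0 \<le> x \<Longrightarrow> x \<le> M \<Longrightarrow> clamp x = x"
  by (simp add: clamp_def)

lemma clamp_nonpos: "x \<le> 0 \<Longrightarrow> clamp x = 0"
  by (simp add: clamp_def)

lemma clamp_le: "0 \<le> c \<Longrightarrow> x \<le> c \<Longrightarrow> clamp x \<le> c"
  by (simp add: clamp_def)

lemma clamp_lipschitz: "\<bar>clamp x - clamp y\<bar> \<le> \<bar>x - y\<bar>"
  using M_ge_1 by (auto simp: clamp_def)

lemma continuous_force [continuous_intros]:
  "continuous_on S f \<Longrightarrow> continuous_on S g \<Longrightarrow> continuous_on S (\<lambda>x. force d (f x) (g x))"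
  unfolding force_def clamp_def by (intro continuous_intros)

lemma force_bound:
  assumes "d \<ge> 0"
  shows "\<bar>force d x y\<bar> \<le> (\<beta> + d) * M\<^sup>2 * clamp x"
proof -
  have "\<beta> * (clamp y)\<^sup>2 \<le> \<beta> * M\<^sup>2" "d * (clamp x)\<^sup>2 \<le> d * M\<^sup>2"
    using clamp_range pos assms by (auto intro!: mult_left_mono power_mono)
  moreover have "0 \<le> \<beta> * (clamp y)\<^sup>2" "0 \<le> d * (clamp x)\<^sup>2"
    using pos assms by auto
  ultimately have "\<bar>\<beta> * (clamp y)\<^sup>2 - d * (clamp x)\<^sup>2\<bar> \<le> \<beta> * M\<^sup>2 + d * M\<^sup>2"
    by linarith
  then have "clamp x * \<bar>\<beta> * (clamp y)\<^sup>2 - d * (clamp x)\<^sup>2\<bar> \<le> clamp x * (\<beta> * M\<^sup>2 + d * M\<^sup>2)"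
    by (intro mult_left_mono clamp_range)
  then show ?thesis
    unfolding force_def abs_mult using clamp_range(1)[of x]
    by (simp add: algebra_simps)
qed

lemma force_lipschitz:
  assumes "d \<ge> 0"
  shows "\<bar>force d x y - force d x' y'\<bar> \<le> 3 * (\<beta> + d) * M\<^sup>2 * (\<bar>x - x'\<bar> + \<bar>y - y'\<bar>)"
proof -
  define a b a' b' where ab: "a = clamp x" "b = clamp y" "a' = clamp x'" "b' = clamp y'"
  have r: "0 \<le> a" "a \<le> M" "0 \<le> b" "b \<le> M" "0 \<le> a'" "a' \<le> M" "0 \<le> b'" "b' \<le> M"
    using clamp_range by (auto simp: ab)
  have bb: "b\<^sup>2 \<le> M\<^sup>2" "a * a \<le> M\<^sup>2" "a * a' \<le> M\<^sup>2" "a' * a' \<le> M\<^sup>2"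
    "a' * b \<le> M\<^sup>2" "a' * b' \<le> M\<^sup>2" "0 \<le> M\<^sup>2"
    using r by (auto intro!: mult_mono simp: power2_eq_square)
  have "a * b\<^sup>2 - a' * b'\<^sup>2 = (a - a') * b\<^sup>2 + (b - b') * (a' * b + a' * b')"
    by (simp add: algebra_simps power2_eq_square)
  also have "\<bar>\<dots>\<bar> \<le> \<bar>a - a'\<bar> * b\<^sup>2 + \<bar>b - b'\<bar> * (a' * b + a' * b')"
    using r by (intro order_trans[OF abs_triangle_ineq]) (auto simp: abs_mult)
  also have "\<dots> \<le> \<bar>a - a'\<bar> * (3 * M\<^sup>2) + \<bar>b - b'\<bar> * (3 * M\<^sup>2)"
    by (intro add_mono mult_left_mono; use bb in linarith)
  finally have 1: "\<bar>a * b\<^sup>2 - a' * b'\<^sup>2\<bar> \<le> 3 * M\<^sup>2 * (\<bar>a - a'\<bar> + \<bar>b - b'\<bar>)"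
    by (simp add: algebra_simps)
  have "a ^ 3 - a' ^ 3 = (a - a') * (a * a + a * a' + a' * a')"
    by (simp add: algebra_simps power3_eq_cube)
  also have "\<bar>\<dots>\<bar> = \<bar>a - a'\<bar> * (a * a + a * a' + a' * a')"
    using r by (simp add: abs_mult)
  also have "\<dots> \<le> \<bar>a - a'\<bar> * (3 * M\<^sup>2)"
    by (intro mult_left_mono; use bb in linarith)
  finally have 2: "\<bar>a ^ 3 - a' ^ 3\<bar> \<le> 3 * M\<^sup>2 * (\<bar>a - a'\<bar> + \<bar>b - b'\<bar>)"
    by (simp add: algebra_simps) (smt (verit) mult_nonneg_nonneg zero_le_power2 abs_ge_zero)
  have "force d x y - force d x' y' = \<beta> * (a * b\<^sup>2 - a' * b'\<^sup>2) - d * (a ^ 3 - a' ^ 3)"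
    unfolding force_def ab[symmetric] by (simp add: algebra_simps power2_eq_square power3_eq_cube)
  also have "\<bar>\<dots>\<bar> \<le> \<beta> * \<bar>a * b\<^sup>2 - a' * b'\<^sup>2\<bar> + d * \<bar>a ^ 3 - a' ^ 3\<bar>"
    using pos assms by (intro order_trans[OF abs_triangle_ineq4]) (auto simp: abs_mult)
  also have "\<dots> \<le> \<beta> * (3 * M\<^sup>2 * (\<bar>a - a'\<bar> + \<bar>b - b'\<bar>)) + d * (3 * M\<^sup>2 * (\<bar>a - a'\<bar> + \<bar>b - b'\<bar>))"
    using 1 2 pos assms by (intro add_mono mult_left_mono) auto
  also have "\<dots> = 3 * (\<beta> + d) * M\<^sup>2 * (\<bar>a - a'\<bar> + \<bar>b - b'\<bar>)"
    by (simp add: algebra_simps)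
  also have "\<dots> \<le> 3 * (\<beta> + d) * M\<^sup>2 * (\<bar>x - x'\<bar> + \<bar>y - y'\<bar>)"
    using clamp_lipschitz pos assms by (intro mult_left_mono add_mono) (auto simp: ab)
  finally show ?thesis .
qed

lemma field_lipschitz:
  obtains L where "L > 0" "\<And>Y Z. norm (field Y - field Z) \<le> L * norm (Y - Z)"
proof -
  define K where "K = 3 * (\<beta> + \<alpha> + \<gamma>) * M\<^sup>2"
  have "K > 0" using pos M_ge_1 by (auto simp: K_def)
  have "norm (field Y - field Z) \<le> (2 + 4 * K) * norm (Y - Z)" for Y Z
  proof -
    obtain u v p q u' v' p' q' where YZ: "Y = (u, v, p, q)" "Z = (u', v', p', q')"
      by (metis prod.exhaust)
    define n where "n = norm (Y - Z)"
    have comp: "\<bar>u - u'\<bar> \<le> n" "\<bar>v - v'\<bar> \<le> n" "\<bar>p - p'\<bar> \<le> n" "\<bar>q - q'\<bar> \<le> n"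
      using norm_fst_le[of "u - u'" "(v - v', p - p', q - q')"]
        norm_snd_le[of "(v - v', p - p', q - q')" "u - u'"]
        norm_fst_le[of "v - v'" "(p - p', q - q')"]
        norm_snd_le[of "(p - p', q - q')" "v - v'"]
        norm_fst_le[of "p - p'" "q - q'"] norm_snd_le[of "q - q'" "p - p'"]
      by (auto simp: n_def YZ)
    have force: "\<bar>force d x y - force d x' y'\<bar> \<le> K * (2 * n)"
      if "d = \<alpha> \<or> d = \<gamma>" "\<bar>x - x'\<bar> \<le> n" "\<bar>y - y'\<bar> \<le> n" for d x y x' y'
    proof -
      have "\<bar>force d x y - force d x' y'\<bar> \<le> 3 * (\<beta> + d) * M\<^sup>2 * (\<bar>x - x'\<bar> + \<bar>y - y'\<bar>)"
        using that pos by (intro force_lipschitz) auto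
      also have "\<dots> \<le> K * (2 * n)"
        unfolding K_def using that pos by (intro mult_mono) auto
      finally show ?thesis .
    qed
    have "norm (field Y - field Z) \<le> \<bar>p - p'\<bar> + (\<bar>q - q'\<bar> +
        (\<bar>force \<alpha> u v - force \<alpha> u' v'\<bar> + \<bar>force \<gamma> v u - force \<gamma> v' u'\<bar>))"
      unfolding YZ field_def
      by (auto intro!: order_trans[OF norm_Pair_le] add_left_mono)
    also have "\<dots> \<le> n + (n + (K * (2 * n) + K * (2 * n)))"
      using comp force by (intro add_mono) auto
    finally show ?thesis by (simp add: n_def algebra_simps)
  qed
  then show ?thesis using that[of "2 + 4 * K"] \<open>K > 0\<close> by simp
qed

end

section \<open>Shooting trajectories\<close>

locale trajectory = competition +
  fixes \<sigma> :: real and u v p q :: "real \<Rightarrow> real"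
  assumes u: "\<And>t. (u has_real_derivative p t) (at t)"
    and v: "\<And>t. (v has_real_derivative q t) (at t)"
    and p: "\<And>t. (p has_real_derivative force \<alpha> (u t) (v t)) (at t)"
    and q: "\<And>t. (q has_real_derivative force \<gamma> (v t) (u t)) (at t)"
    and init: "u 0 = \<sigma>" "v 0 = 1" "p 0 = 0" "q 0 = 0"
    and \<sigma>: "0 \<le> \<sigma>" "\<sigma>\<^sup>2 \<le> \<gamma> / \<beta>"
begin

text \<open>
  Both velocities vanish at time 0. The disjunctions say that u keeps growing, or that v keeps
  decreasing, in a form that is an open condition on the closed time interval including 0.
\<close>
definition v_turns_first :: bool where
  "v_turns_first \<longleftrightarrow> (\<exists>t\<ge>0. q t > 0 \<and> (\<forall>\<tau>\<in>{0..t}. p \<tau> > 0 \<or> force \<alpha> (u \<tau>) (v \<tau>) > 0))"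

definition u_turns_first :: bool where
  "u_turns_first \<longleftrightarrow> (\<exists>t\<ge>0. (p t < 0 \<or> v t < 0) \<and>
     (\<forall>\<tau>\<in>{0..t}. q \<tau> < 0 \<or> force \<gamma> (v \<tau>) (u \<tau>) < 0))"

lemma isCont_components: "isCont u t" "isCont v t" "isCont p t" "isCont q t"
  by (rule DERIV_isCont, rule u v p q)+

lemma continuous_on_components: "continuous_on S u" "continuous_on S v" "continuous_on S p" "continuous_on S q"
  by (intro continuous_at_imp_continuous_on ballI isCont_components)+

lemma \<sigma>_sq: "\<alpha> * \<sigma>\<^sup>2 < \<beta>"
proof -
  have "\<alpha> * \<sigma>\<^sup>2 \<le> \<alpha> * (\<gamma> / \<beta>)" using \<sigma> pos by (intro mult_left_mono) auto
  also have "\<dots> < \<beta>" using strong pos by (simp add: divide_less_eq power2_eq_square)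
  finally show ?thesis .
qed

lemma \<sigma>_less_M: "\<sigma> < M"
proof -
  have "\<alpha> * \<sigma>\<^sup>2 < \<alpha> * M\<^sup>2" using \<sigma>_sq M_sq pos by linarith
  then have "\<sigma>\<^sup>2 < M\<^sup>2" using pos by simp
  then show ?thesis by (rule power2_less_imp_less) (use M_ge_1 in simp)
qed

lemma components_monotone:
  assumes "\<And>t. a \<le> t \<Longrightarrow> t \<le> b \<Longrightarrow> p t \<ge> 0 \<and> q t \<le> 0" "a \<le> s" "s \<le> t" "t \<le> b"
  shows "u s \<le> u t" "v t \<le> v s"
proof -
  show "u s \<le> u t"
    by (rule DERIV_nonneg_imp_nondecreasing[OF \<open>s \<le> t\<close>]) (use assms u in force)
  show "v t \<le> v s"
    by (rule DERIV_nonpos_imp_nonincreasing[OF \<open>s \<le> t\<close>]) (use assms v in force)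
qed

text \<open>
  While u grows and v \<le> 1, the energy p^2/2 + \<alpha> u^4/4 - \<beta> u^2/2 of the equation
  u'' = u (\<beta> - \<alpha> u^2) does not increase. It is nonpositive at time 0, but it would be positive at u = M.
\<close>
lemma components_bounded:
  assumes dir: "\<And>t. 0 \<le> t \<Longrightarrow> t \<le> T \<Longrightarrow> p t \<ge> 0 \<and> q t \<le> 0" and t: "0 \<le> t" "t \<le> T"
  shows "\<sigma> \<le> u t" "u t \<le> M" "v t \<le> 1"
proof -
  show "\<sigma> \<le> u t" "v t \<le> 1"
    using components_monotone[of 0 T 0 t] dir t init by auto
  show "u t \<le> M"
  proof (rule ccontr)
    assume "\<not> u t \<le> M"
    then obtain s where s: "0 \<le> s" "s \<le> t" "u s = M"
      using IVT'[of u 0 M t] t continuous_on_components(1) \<sigma>_less_M init by auto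
    define h where "h = (\<lambda>t. (p t)\<^sup>2 / 2 + \<alpha> * (u t) ^ 4 / 4 - \<beta> * (u t)\<^sup>2 / 2)"
    have "h s \<le> h 0"
    proof (rule DERIV_nonpos_imp_nonincreasing[OF s(1)])
      fix x assume x: "0 \<le> x" "x \<le> s"
      have "0 \<le> u x" "u x \<le> M" "v x \<le> 1"
        using components_monotone[of 0 T 0 x] components_monotone[of 0 T x s] dir x s t init \<sigma> by auto
      then have c: "clamp (u x) = u x" "0 \<le> clamp (v x)" "clamp (v x) \<le> 1"
        using clamp_le[of 1 "v x"] by (auto simp: clamp_id clamp_range)
      have "(h has_real_derivative
          (p x * force \<alpha> (u x) (v x) + \<alpha> * (u x) ^ 3 * p x - \<beta> * u x * p x)) (at x)"
        unfolding h_def by (auto intro!: derivative_eq_intros u p)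
      moreover have "p x * force \<alpha> (u x) (v x) + \<alpha> * (u x) ^ 3 * p x - \<beta> * u x * p x
          = p x * u x * \<beta> * ((clamp (v x))\<^sup>2 - 1)"
        unfolding force_def c by (simp add: algebra_simps power2_eq_square power3_eq_cube)
      moreover have "\<dots> \<le> 0"
      proof (rule mult_nonneg_nonpos)
        show "0 \<le> p x * u x * \<beta>" using dir[of x] x s t \<open>0 \<le> u x\<close> pos by simp
        show "(clamp (v x))\<^sup>2 - 1 \<le> 0" using c by (simp add: power_le_one)
      qed
      ultimately show "\<exists>y. (h has_real_derivative y) (at x) \<and> y \<le> 0" by metis
    qed
    also have "h 0 = \<sigma>\<^sup>2 / 4 * (\<alpha> * \<sigma>\<^sup>2 - 2 * \<beta>)"
      unfolding h_def init by (simp add: algebra_simps power2_eq_square power4_eq_xxxx)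
    also have "\<dots> \<le> 0"
      using \<sigma>_sq pos by (intro mult_nonneg_nonpos) auto
    finally have "(p s)\<^sup>2 / 2 + M\<^sup>2 / 4 * (\<alpha> * M\<^sup>2 - 2 * \<beta>) \<le> 0"
      unfolding h_def s by (simp add: algebra_simps power2_eq_square power4_eq_xxxx)
    moreover have "M\<^sup>2 / 4 * (\<alpha> * M\<^sup>2 - 2 * \<beta>) > 0"
      using M_sq M_ge_1 by (intro mult_pos_pos) auto
    moreover have "(p s)\<^sup>2 / 2 \<ge> 0" by simp
    ultimately show False by linarith
  qed
qed

text \<open>
  If v turns around while u grows, the other alternative can only have come about through a negative
  v before that time. But once v is negative and decreasing, the truncation freezes its velocity, and
  v never turns around.
\<close>
lemma not_both_turn_first: "\<not> (v_turns_first \<and> u_turns_first)"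
proof
  assume "v_turns_first \<and> u_turns_first"
  then obtain t s where t: "0 \<le> t" "q t > 0"
    "\<And>\<tau>. 0 \<le> \<tau> \<Longrightarrow> \<tau> \<le> t \<Longrightarrow> p \<tau> > 0 \<or> force \<alpha> (u \<tau>) (v \<tau>) > 0"
    and s: "0 \<le> s" "p s < 0 \<or> v s < 0"
    "\<And>\<tau>. 0 \<le> \<tau> \<Longrightarrow> \<tau> \<le> s \<Longrightarrow> q \<tau> < 0 \<or> force \<gamma> (v \<tau>) (u \<tau>) < 0"
    unfolding v_turns_first_def u_turns_first_def by auto
  have p_pos: "p \<tau> > 0" if "0 < \<tau>" "\<tau> \<le> t" for \<tau>
    using positive_after_of_derivative_positive_where_nonpositive[OF p, of t \<tau>] t that init by auto
  have q_neg: "- q \<tau> > 0" if "0 < \<tau>" "\<tau> \<le> s" for \<tau>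
    using positive_after_of_derivative_positive_where_nonpositive[OF DERIV_minus[OF q], of s \<tau>]
      s that init by auto
  have "t \<noteq> 0" "s \<noteq> 0" using t(2) s(2) init by auto
  then have "t > 0" "s > 0" using t(1) s(1) by auto
  then have "s < t" using q_neg[of t] t(2) by (cases "t \<le> s") auto
  then have "v s < 0" "q s < 0" using p_pos[of s] s \<open>s < t\<close> q_neg[of s] \<open>s > 0\<close> by auto
  have "continuous_on {s..t} (\<lambda>t. - q t)"
    by (intro continuous_on_minus continuous_on_components)
  then obtain c where c: "s < c" "- q c = 0" "\<And>x. s \<le> x \<Longrightarrow> x < c \<Longrightarrow> - q x > 0"
    using first_zero[of s t "\<lambda>t. - q t"] \<open>q s < 0\<close> \<open>s < t\<close> t(2)
    by (metis less_imp_le neg_0_less_iff_less neg_le_0_iff_le)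
  have "v x \<le> v s" if "s \<le> x" "x \<le> c" for x
  proof (rule DERIV_nonpos_imp_nonincreasing[OF that(1)])
    fix y assume "s \<le> y" "y \<le> x"
    then have "q y \<le> 0" using c(2) c(3)[of y] that by (cases "y = c") auto
    then show "\<exists>z. (v has_real_derivative z) (at y) \<and> z \<le> 0" using v by blast
  qed
  then have "force \<gamma> (v x) (u x) = 0" if "s \<le> x" "x \<le> c" for x
    using that \<open>v s < 0\<close> clamp_nonpos[of "v x"] by (force simp: force_def)
  then have "(q has_real_derivative 0) (at x)" if "s \<le> x" "x \<le> c" for x
    using q[of x] that by simp
  then have "q c \<le> q s"
    using c(1) by (intro DERIV_nonpos_imp_nonincreasing[of s c q]) auto
  then show False using c \<open>q s < 0\<close> by simp
qed

text \<open>
  For \<sigma> = 0 the component u remains 0, and v follows v'' = -\<gamma> v^3 until it crosses 0.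
\<close>
lemma u_turns_first_if_u_absent:
  assumes "\<sigma> = 0"
  shows u_turns_first
proof -
  define K where "K = (\<beta> + \<alpha>) * M\<^sup>2"
  have K: "\<bar>force \<alpha> (u t) (v t)\<bar> \<le> K * \<bar>u t\<bar>" for t
  proof -
    have "clamp (u t) \<le> \<bar>u t\<bar>" by (simp add: clamp_def)
    then have "K * clamp (u t) \<le> K * \<bar>u t\<bar>"
      using pos by (intro mult_left_mono) (auto simp: K_def)
    then show ?thesis using force_bound[of \<alpha> "u t" "v t"] pos unfolding K_def by linarith
  qed
  have u0: "u t = 0" if "0 \<le> t" for t
  proof -
    \<comment> \<open>Gronwall's inequality for u^2 + p^2, which vanishes at time 0.\<close>
    define e where "e = (\<lambda>t. ((u t)\<^sup>2 + (p t)\<^sup>2) * exp (- (1 + K) * t))"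
    have "e t \<le> e 0"
    proof (rule DERIV_nonpos_imp_nonincreasing[OF that])
      fix x
      define a where "a = force \<alpha> (u x) (v x)"
      have "(e has_real_derivative
          (2 * u x * p x + 2 * p x * a - (1 + K) * ((u x)\<^sup>2 + (p x)\<^sup>2)) * exp (- (1 + K) * x)) (at x)"
        unfolding e_def a_def
        by (auto intro!: derivative_eq_intros u p simp: algebra_simps)
      moreover have "2 * u x * p x + 2 * p x * a \<le> (1 + K) * ((u x)\<^sup>2 + (p x)\<^sup>2)"
      proof -
        have up: "2 * \<bar>u x\<bar> * \<bar>p x\<bar> \<le> (u x)\<^sup>2 + (p x)\<^sup>2"
          using sum_squares_bound[of "\<bar>u x\<bar>" "\<bar>p x\<bar>"] by simp
        have "2 * p x * a \<le> 2 * \<bar>p x\<bar> * \<bar>a\<bar>"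
          using abs_ge_self[of "p x * a"] by (simp add: abs_mult)
        also have "\<dots> \<le> 2 * \<bar>p x\<bar> * (K * \<bar>u x\<bar>)"
          using K[of x] by (intro mult_left_mono) (auto simp: a_def)
        also have "\<dots> = K * (2 * \<bar>u x\<bar> * \<bar>p x\<bar>)" by simp
        also have "\<dots> \<le> K * ((u x)\<^sup>2 + (p x)\<^sup>2)"
          using up pos by (intro mult_left_mono) (auto simp: K_def)
        finally have "2 * p x * a \<le> K * ((u x)\<^sup>2 + (p x)\<^sup>2)" .
        moreover have "2 * u x * p x \<le> 2 * \<bar>u x\<bar> * \<bar>p x\<bar>"
          using abs_ge_self[of "u x * p x"] by (simp add: abs_mult)
        ultimately show ?thesis using up by (simp add: algebra_simps)
      qed
      ultimately show "\<exists>y. (e has_real_derivative y) (at x) \<and> y \<le> 0"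
        by (intro exI conjI) (assumption, intro mult_nonpos_nonneg, auto)
    qed
    then have "(u t)\<^sup>2 + (p t)\<^sup>2 \<le> 0"
      by (simp add: e_def init assms mult_le_0_iff)
    then show ?thesis by (simp add: sum_power2_le_zero_iff)
  qed
  have F: "force \<gamma> (v t) (u t) = - \<gamma> * (clamp (v t)) ^ 3" if "0 \<le> t" for t
    using u0[OF that] by (simp add: force_def clamp_nonpos power2_eq_square power3_eq_cube)
  have mono: "q t \<le> q s" if "0 \<le> s" "s \<le> t" for s t
  proof (rule DERIV_nonpos_imp_nonincreasing[OF that(2)])
    fix x assume "s \<le> x"
    then have "force \<gamma> (v x) (u x) \<le> 0"
      using F[of x] that clamp_range pos by simp
    then show "\<exists>y. (q has_real_derivative y) (at x) \<and> y \<le> 0" using q by blast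
  qed
  have F0: "force \<gamma> (v 0) (u 0) < 0"
    using F[of 0] init M_ge_1 pos by (simp add: clamp_id)
  then obtain d where d: "d > 0" "\<And>h. 0 < h \<Longrightarrow> h < d \<Longrightarrow> q (0 + h) < q 0"
    using DERIV_neg_dec_right[OF q] by blast
  have q_neg: "q t < 0" if "0 < t" for t
  proof -
    define h where "h = min d t / 2"
    have "0 < h" "h < d" "h \<le> t" using d(1) that by (auto simp: h_def)
    then show ?thesis using d(2)[of h] mono[of h t] init by simp
  qed
  define m where "m = - q 1"
  have "m > 0" using q_neg[of 1] by (simp add: m_def)
  define t where "t = 1 + 2 / m"
  have "t \<ge> 1" using \<open>m > 0\<close> by (simp add: t_def)
  have "v t + m * t \<le> v 1 + m * 1"
  proof (rule DERIV_nonpos_imp_nonincreasing[OF \<open>t \<ge> 1\<close>])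
    fix x :: real assume "1 \<le> x"
    have "((\<lambda>t. v t + m * t) has_real_derivative q x + m) (at x)"
      by (auto intro!: derivative_eq_intros v)
    then show "\<exists>y. ((\<lambda>t. v t + m * t) has_real_derivative y) (at x) \<and> y \<le> 0"
      using mono[of 1 x] \<open>1 \<le> x\<close> by (intro exI[of _ "q x + m"]) (auto simp: m_def)
  qed
  moreover have "v 1 \<le> v 0"
    by (rule DERIV_nonpos_imp_nonincreasing) (use v mono[of 0] init in force)+
  moreover have "m * t = m + 2" using \<open>m > 0\<close> by (simp add: t_def field_simps)
  ultimately have "v t < 0" using init by simp
  moreover have "q \<tau> < 0 \<or> force \<gamma> (v \<tau>) (u \<tau>) < 0" if "0 \<le> \<tau>" for \<tau>
    using q_neg[of \<tau>] F0 that by (cases "\<tau> = 0") auto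
  ultimately show ?thesis
    unfolding u_turns_first_def using \<open>t \<ge> 1\<close> by (intro exI[of _ t]) auto
qed

lemma initial_force_u: "0 < \<sigma> \<Longrightarrow> force \<alpha> (u 0) (v 0) > 0"
  using \<sigma>_sq \<sigma>_less_M M_ge_1 by (simp add: force_def init clamp_id)

lemma isCont_force:
  "isCont (\<lambda>t. force \<alpha> (u t) (v t)) t" "isCont (\<lambda>t. force \<gamma> (v t) (u t)) t"
proof -
  have "continuous_on UNIV (\<lambda>t. force \<alpha> (u t) (v t))" "continuous_on UNIV (\<lambda>t. force \<gamma> (v t) (u t))"
    by (intro continuous_force continuous_on_components)+
  then show "isCont (\<lambda>t. force \<alpha> (u t) (v t)) t" "isCont (\<lambda>t. force \<gamma> (v t) (u t)) t"
    by (simp_all add: continuous_on_eq_continuous_at)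
qed

text \<open>
  Here v''(0) = 0, but as soon as u has grown at all, \<beta> u^2 > \<gamma> v^2 and v accelerates.
\<close>
lemma v_turns_first_if_v_balanced:
  assumes "\<sigma>\<^sup>2 = \<gamma> / \<beta>"
  shows v_turns_first
proof -
  have "0 < \<sigma>" using assms pos \<sigma> by (cases "\<sigma> = 0") auto
  obtain e1 where e1: "e1 > 0" "\<And>t. \<bar>t - 0\<bar> < e1 \<Longrightarrow> force \<alpha> (u t) (v t) > 0"
    using isCont_positive_near[OF isCont_force(1) initial_force_u[OF \<open>0 < \<sigma>\<close>]] by blast
  have "v 0 > 0" by (simp add: init)
  then obtain e2 where e2: "e2 > 0" "\<And>t. \<bar>t - 0\<bar> < e2 \<Longrightarrow> v t > 0"
    using isCont_positive_near[OF isCont_components(2)] by blast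
  define d where "d = min e1 e2 / 2"
  have d: "d > 0" "\<And>t. 0 \<le> t \<Longrightarrow> t \<le> d \<Longrightarrow> force \<alpha> (u t) (v t) > 0 \<and> v t > 0"
    using e1 e2 by (auto simp: d_def)
  show ?thesis
  proof (rule ccontr)
    assume "\<not> v_turns_first"
    then have q_le: "q t \<le> 0" if "0 \<le> t" "t \<le> d" for t
      using that d(2) unfolding v_turns_first_def by (force simp: not_less)
    have p_pos: "p t > 0" if "0 < t" "t \<le> d" for t
      using positive_after_of_derivative_positive_where_nonpositive[OF p, of d t] d that init by auto
    have dir: "p t \<ge> 0 \<and> q t \<le> 0" if "0 \<le> t" "t \<le> d" for t
      using q_le[OF that] p_pos[of t] init that by (cases "t = 0") auto
    have "q 0 < q d"
    proof (rule DERIV_pos_imp_increasing_open[OF \<open>d > 0\<close>])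
      fix t assume t: "0 < t" "t < d"
      have "u 0 < u t"
        by (rule DERIV_pos_imp_increasing_open[OF t(1)])
          (use u p_pos t continuous_on_components(1) in \<open>force+\<close>)
      then have "\<sigma> < u t" "u t \<le> M" "v t \<le> 1" "0 < v t"
        using components_bounded[of d t] dir t d(2)[of t] init by auto
      then have c: "clamp (u t) = u t" "clamp (v t) = v t"
        using M_ge_1 \<sigma> by (auto intro!: clamp_id)
      have "\<gamma> * (v t)\<^sup>2 \<le> \<gamma> * 1"
        using \<open>v t \<le> 1\<close> \<open>0 < v t\<close> pos by (intro mult_left_mono power_le_one) auto
      also have "\<gamma> * 1 = \<beta> * \<sigma>\<^sup>2" using assms pos by simp
      also have "\<dots> < \<beta> * (u t)\<^sup>2"
        using \<open>\<sigma> < u t\<close> \<sigma> pos by (intro mult_strict_left_mono power_strict_mono) auto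
      finally have "force \<gamma> (v t) (u t) > 0"
        using \<open>0 < v t\<close> by (simp add: force_def c)
      then show "\<exists>y. (q has_real_derivative y) (at t) \<and> 0 < y" using q by blast
    qed (rule continuous_on_components)
    then show False using q_le[of d] d(1) init by simp
  qed
qed

text \<open>
  Otherwise u and v converge to an equilibrium with u > 0, for which \<beta> v^2 = \<alpha> u^2 and
  \<beta> u^2 = \<gamma> v^2. This contradicts \<beta>^2 > \<alpha> \<gamma>.
\<close>
lemma velocities_do_not_keep_sign:
  assumes "0 < \<sigma>" and v_nonneg: "\<And>t. 0 \<le> t \<Longrightarrow> v t \<ge> 0"
    and dir: "\<And>t. 0 \<le> t \<Longrightarrow> p t \<ge> 0 \<and> q t \<le> 0"
  shows False
proof -
  have b: "\<sigma> \<le> u t" "u t \<le> M" "v t \<le> 1" if "0 \<le> t" for t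
    using components_bounded[of t t] dir that by auto
  have abs_u: "\<bar>u t\<bar> \<le> M" if "0 \<le> t" for t using b[OF that] \<sigma> by auto
  have abs_v: "\<bar>v t\<bar> \<le> 1" if "0 \<le> t" for t using b[OF that] v_nonneg[OF that] by auto
  have mono: "u s \<le> u t" "- v s \<le> - v t" if "0 \<le> s" "s \<le> t" for s t
    using components_monotone[of 0 t s t] dir that by auto
  obtain U where U: "(u \<longlongrightarrow> U) at_top" "u 0 \<le> U"
    by (rule increasing_bounded_converges[OF mono(1) b(2)])
  have v_bound: "- v t \<le> 0" if "0 \<le> t" for t using v_nonneg[OF that] by simp
  obtain V where "((\<lambda>t. - v t) \<longlongrightarrow> V) at_top" "- v 0 \<le> V"
    by (rule increasing_bounded_converges[OF mono(2) v_bound])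
  from tendsto_minus[OF this(1)] have V: "(v \<longlongrightarrow> - V) at_top" by simp
  have "U > 0" using U(2) init \<open>0 < \<sigma>\<close> by simp
  have ev: "\<forall>\<^sub>F t in at_top. clamp (u t) = u t \<and> clamp (v t) = v t"
    using eventually_ge_at_top[of 0]
  proof eventually_elim
    case (elim t)
    then show ?case
      using b[of t] v_nonneg[of t] \<sigma> M_ge_1 by (auto intro!: clamp_id)
  qed
  have "((\<lambda>t. u t * (\<beta> * (v t)\<^sup>2 - \<alpha> * (u t)\<^sup>2)) \<longlongrightarrow> U * (\<beta> * (- V)\<^sup>2 - \<alpha> * U\<^sup>2)) at_top"
    by (intro tendsto_intros U V)
  then have limF: "((\<lambda>t. force \<alpha> (u t) (v t)) \<longlongrightarrow> U * (\<beta> * (- V)\<^sup>2 - \<alpha> * U\<^sup>2)) at_top"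
    by (rule Lim_transform_eventually) (rule eventually_mono[OF ev], simp add: force_def)
  have "((\<lambda>t. v t * (\<beta> * (u t)\<^sup>2 - \<gamma> * (v t)\<^sup>2)) \<longlongrightarrow> (- V) * (\<beta> * U\<^sup>2 - \<gamma> * (- V)\<^sup>2)) at_top"
    by (intro tendsto_intros U V)
  then have limG: "((\<lambda>t. force \<gamma> (v t) (u t)) \<longlongrightarrow> (- V) * (\<beta> * U\<^sup>2 - \<gamma> * (- V)\<^sup>2)) at_top"
    by (rule Lim_transform_eventually) (rule eventually_mono[OF ev], simp add: force_def)
  have "U * (\<beta> * (- V)\<^sup>2 - \<alpha> * U\<^sup>2) = 0"
    by (rule bounded_second_derivative_limit_zero[OF u p limF abs_u])
  then have 1: "\<beta> * V\<^sup>2 = \<alpha> * U\<^sup>2" using \<open>U > 0\<close> by simp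
  then have "V \<noteq> 0" using pos \<open>U > 0\<close> by auto
  have "(- V) * (\<beta> * U\<^sup>2 - \<gamma> * (- V)\<^sup>2) = 0"
    by (rule bounded_second_derivative_limit_zero[OF v q limG abs_v])
  then have 2: "\<beta> * U\<^sup>2 = \<gamma> * V\<^sup>2" using \<open>V \<noteq> 0\<close> by simp
  have "\<beta>\<^sup>2 * U\<^sup>2 = \<beta> * (\<beta> * U\<^sup>2)" by (simp add: power2_eq_square)
  also have "\<dots> = \<gamma> * (\<beta> * V\<^sup>2)" unfolding 2 by simp
  also have "\<dots> = \<alpha> * \<gamma> * U\<^sup>2" unfolding 1 by simp
  finally have "\<beta>\<^sup>2 = \<alpha> * \<gamma>" using \<open>U > 0\<close> by simp
  then show False using strong by simp
qed

text \<open>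
  Let T be the first time at which one of the velocities vanishes. Until then the ratio u / v
  increases. If v alone stops at time T, its acceleration at T is positive: otherwise, by monotonicity
  of the ratio, it would have been nonpositive all along, and v could not have come to rest. But then
  v turns around while u is still growing. If u alone stops at time T, the same reasoning shows that u
  turns around while v is still decreasing.
\<close>
lemma simultaneous_rest:
  assumes "0 < \<sigma>" "\<sigma>\<^sup>2 < \<gamma> / \<beta>" "\<not> v_turns_first" "\<not> u_turns_first"
  obtains T where "T > 0" "p T = 0" "q T = 0"
    "\<And>t. 0 \<le> t \<Longrightarrow> t \<le> T \<Longrightarrow> 0 < u t \<and> u t \<le> M \<and> 0 < v t \<and> v t \<le> M"
proof -
  have F0: "force \<alpha> (u 0) (v 0) > 0" using initial_force_u assms by simp
  have "\<beta> * \<sigma>\<^sup>2 < \<gamma>" using assms(2) pos by (simp add: field_simps)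
  then have G0: "force \<gamma> (v 0) (u 0) < 0"
    using \<sigma> \<sigma>_less_M M_ge_1 by (simp add: force_def init clamp_id)
  obtain d1 where d1: "d1 > 0" "\<And>h. 0 < h \<Longrightarrow> h < d1 \<Longrightarrow> p 0 < p (0 + h)"
    using DERIV_pos_inc_right[OF p F0] by blast
  obtain d2 where d2: "d2 > 0" "\<And>h. 0 < h \<Longrightarrow> h < d2 \<Longrightarrow> q (0 + h) < q 0"
    using DERIV_neg_dec_right[OF q G0] by blast
  define a where "a = min d1 d2 / 2"
  have "a > 0" using d1 d2 by (simp add: a_def)
  have early: "p t > 0 \<and> q t < 0" if "0 < t" "t \<le> a" for t
    using d1(2)[of t] d2(2)[of t] that d1(1) d2(1) init by (auto simp: a_def min_def split: if_splits)
  define g where "g = (\<lambda>t. min (p t) (- q t))"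
  have contg: "continuous_on S g" for S
    unfolding g_def by (intro continuous_intros continuous_on_components)
  have v_nonneg: "v t \<ge> 0" if "0 \<le> t" "\<And>\<tau>. 0 < \<tau> \<Longrightarrow> \<tau> \<le> t \<Longrightarrow> q \<tau> < 0" for t
  proof (rule ccontr)
    assume neg: "\<not> v t \<ge> 0"
    have "q \<tau> < 0 \<or> force \<gamma> (v \<tau>) (u \<tau>) < 0" if "\<tau> \<in> {0..t}" for \<tau>
    proof (cases "\<tau> = 0")
      case True
      then show ?thesis using G0 by simp
    next
      case False
      then show ?thesis using \<open>\<And>\<tau>. 0 < \<tau> \<Longrightarrow> \<tau> \<le> t \<Longrightarrow> q \<tau> < 0\<close>[of \<tau>] that by simp
    qed
    then have u_turns_first
      unfolding u_turns_first_def using \<open>0 \<le> t\<close> neg by (intro exI[of _ t] conjI ballI) simp_all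
    then show False using assms(4) by simp
  qed
  have "\<exists>b>a. g b \<le> 0"
  proof (rule ccontr)
    assume none: "\<not> ?thesis"
    have sgn: "p t > 0 \<and> q t < 0" if "0 < t" for t
    proof (cases "t \<le> a")
      case True
      then show ?thesis using early that by simp
    next
      case False
      then have "\<not> g t \<le> 0" using none by (meson not_le)
      then show ?thesis by (auto simp: g_def min_def split: if_splits)
    qed
    show False
    proof (rule velocities_do_not_keep_sign[OF \<open>0 < \<sigma>\<close>])
      show "v t \<ge> 0" if "0 \<le> t" for t by (rule v_nonneg[OF that]) (simp add: sgn)
      show "p t \<ge> 0 \<and> q t \<le> 0" if "0 \<le> t" for t
        using sgn[of t] init that by (cases "t = 0") auto
    qed
  qed
  then obtain b where "a < b" "g b \<le> 0" by blast
  have "g a > 0" using early[of a] \<open>a > 0\<close> by (simp add: g_def)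
  have "\<exists>T. a < T \<and> g T = 0 \<and> (\<forall>t. a \<le> t \<longrightarrow> t < T \<longrightarrow> g t > 0)"
    by (rule first_zero[OF contg less_imp_le[OF \<open>a < b\<close>] \<open>g a > 0\<close> \<open>g b \<le> 0\<close>]) blast
  then obtain T where T: "a < T" "g T = 0" "\<And>t. a \<le> t \<Longrightarrow> t < T \<Longrightarrow> g t > 0"
    by blast
  have "T > 0" using T \<open>a > 0\<close> by simp
  have sgn: "p t > 0 \<and> q t < 0" if "0 < t" "t < T" for t
    using early[of t] T(3)[of t] that by (cases "t \<le> a") (auto simp: g_def)
  have dir: "p t \<ge> 0 \<and> q t \<le> 0" if "0 \<le> t" "t \<le> T" for t
    using sgn[of t] init T(2) that by (cases "t = 0"; cases "t = T") (auto simp: g_def min_def split: if_splits)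
  have vT: "v T \<ge> 0"
  proof (rule ccontr)
    assume "\<not> v T \<ge> 0"
    then obtain e where e: "e > 0" "\<And>t. \<bar>t - T\<bar> < e \<Longrightarrow> - v t > 0"
      using isCont_positive_near[where f = "\<lambda>t. - v t" and x = T] isCont_components(2)[of T] by auto
    define h where "h = min e T / 2"
    have "0 < h" "h < e" "h < T" using e(1) \<open>T > 0\<close> by (auto simp: h_def)
    then show False using e(2)[of "T - h"] v_nonneg[of "T - h"] sgn by auto
  qed
  have B: "\<sigma> \<le> u t" "u t \<le> M" "v t \<le> 1" "v T \<le> v t" "u t \<le> u T" if "0 \<le> t" "t \<le> T" for t
    using components_bounded[of T t] components_monotone[of 0 T t T] dir that by auto
  have c: "clamp (u t) = u t" "clamp (v t) = v t" if "0 \<le> t" "t \<le> T" for t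
    using B[OF that] vT \<sigma> M_ge_1 by (auto intro!: clamp_id)
  have sq: "(u t)\<^sup>2 \<le> (u T)\<^sup>2" "(v T)\<^sup>2 \<le> (v t)\<^sup>2" if "0 \<le> t" "t \<le> T" for t
    using B[OF that] vT \<sigma> by (auto intro!: power_mono)
  have u_pos: "u t > 0" if "0 \<le> t" "t \<le> T" for t
    using B[OF that] \<open>0 < \<sigma>\<close> by linarith
  define k where "k = sqrt ((\<beta> + \<gamma>) * M\<^sup>2)"
  have "k > 0" "k\<^sup>2 = (\<beta> + \<gamma>) * M\<^sup>2" using pos M_ge_1 by (auto simp: k_def)
  have "q T < k * v T"
  proof (rule derivative_below_exponential_rate[OF v q])
    show "force \<gamma> (v t) (u t) \<le> k\<^sup>2 * v t" if "0 \<le> t" "t \<le> T" for t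
      using force_bound[of \<gamma> "v t" "u t"] pos c[OF that] \<open>k\<^sup>2 = _\<close> by simp
  qed (use init \<open>k > 0\<close> \<open>T > 0\<close> in auto)
  have qT: "q T = 0"
  proof (rule ccontr)
    assume "q T \<noteq> 0"
    then have "q T < 0" "p T = 0" using dir[of T] T(2) \<open>T > 0\<close> by (auto simp: g_def min_def split: if_splits)
    have "force \<alpha> (u T) (v T) < 0"
    proof (rule ccontr)
      assume "\<not> ?thesis"
      then have "\<alpha> * (u T)\<^sup>2 \<le> \<beta> * (v T)\<^sup>2"
        using u_pos[of T] \<open>T > 0\<close> by (simp add: force_def c not_less zero_le_mult_iff)
      then have "force \<alpha> (u t) (v t) \<ge> 0" if "0 \<le> t" "t \<le> T" for t
        unfolding force_def c[OF that] using u_pos[OF that]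
          mult_left_mono[OF sq(1)[OF that], of \<alpha>] mult_left_mono[OF sq(2)[OF that], of \<beta>] pos
        by (intro mult_nonneg_nonneg) linarith+
      then have "p a \<le> p T"
        using T(1) \<open>a > 0\<close> p by (intro DERIV_nonneg_imp_nondecreasing[of a T p]) force+
      then show False using early[of a] \<open>a > 0\<close> \<open>p T = 0\<close> by simp
    qed
    then obtain d where d: "d > 0" "\<And>h. 0 < h \<Longrightarrow> h < d \<Longrightarrow> p (T + h) < p T"
      using DERIV_neg_dec_right[OF p] by blast
    obtain e where e: "e > 0" "\<And>t. \<bar>t - T\<bar> < e \<Longrightarrow> - q t > 0"
      using isCont_positive_near[where f = "\<lambda>t. - q t" and x = T] \<open>q T < 0\<close> isCont_components(4)[of T] by auto
    define h where "h = min d e / 2"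
    have h: "0 < h" "h < d" "h < e" using d e by (auto simp: h_def min_def)
    have "q \<tau> < 0 \<or> force \<gamma> (v \<tau>) (u \<tau>) < 0" if "0 \<le> \<tau>" "\<tau> \<le> T + h" for \<tau>
      using that G0 sgn[of \<tau>] e(2)[of \<tau>] h by (cases "\<tau> = 0"; cases "\<tau> < T") auto
    moreover have "p (T + h) < 0" using d(2) h \<open>p T = 0\<close> by force
    ultimately have u_turns_first
      unfolding u_turns_first_def using h \<open>T > 0\<close> by (intro exI[of _ "T + h"]) auto
    then show False using assms by simp
  qed
  then have "v T > 0" using \<open>q T < k * v T\<close> \<open>k > 0\<close> by (simp add: zero_less_mult_iff)
  have pT: "p T = 0"
  proof (rule ccontr)
    assume "p T \<noteq> 0"
    then have "p T > 0" using dir[of T] \<open>T > 0\<close> by force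
    have "force \<gamma> (v T) (u T) > 0"
    proof (rule ccontr)
      assume "\<not> ?thesis"
      then have "\<beta> * (u T)\<^sup>2 \<le> \<gamma> * (v T)\<^sup>2"
        using \<open>v T > 0\<close> \<open>T > 0\<close> by (simp add: force_def c not_less mult_le_0_iff)
      then have "force \<gamma> (v t) (u t) \<le> 0" if "0 \<le> t" "t \<le> T" for t
        unfolding force_def c[OF that] using \<open>v T > 0\<close> B(4)[OF that]
          mult_left_mono[OF sq(1)[OF that], of \<beta>] mult_left_mono[OF sq(2)[OF that], of \<gamma>] pos
        by (intro mult_nonneg_nonpos) linarith+
      then have "q T \<le> q a"
        using T(1) \<open>a > 0\<close> q by (intro DERIV_nonpos_imp_nonincreasing[of a T q]) force+
      then show False using early[of a] \<open>a > 0\<close> qT by simp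
    qed
    then obtain d where d: "d > 0" "\<And>h. 0 < h \<Longrightarrow> h < d \<Longrightarrow> q T < q (T + h)"
      using DERIV_pos_inc_right[OF q] by blast
    obtain e where e: "e > 0" "\<And>t. \<bar>t - T\<bar> < e \<Longrightarrow> p t > 0"
      using isCont_positive_near[OF isCont_components(3) \<open>p T > 0\<close>] by blast
    define h where "h = min d e / 2"
    have h: "0 < h" "h < d" "h < e" using d e by (auto simp: h_def min_def)
    have "p \<tau> > 0 \<or> force \<alpha> (u \<tau>) (v \<tau>) > 0" if "0 \<le> \<tau>" "\<tau> \<le> T + h" for \<tau>
      using that F0 sgn[of \<tau>] e(2)[of \<tau>] h by (cases "\<tau> = 0"; cases "\<tau> < T") auto
    moreover have "q (T + h) > 0" using d(2) h qT by force
    ultimately have v_turns_first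
      unfolding v_turns_first_def using h \<open>T > 0\<close> by (intro exI[of _ "T + h"]) auto
    then show False using assms by simp
  qed
  show ?thesis
  proof (rule that[OF \<open>T > 0\<close> pT qT])
    show "0 < u t \<and> u t \<le> M \<and> 0 < v t \<and> v t \<le> M" if "0 \<le> t" "t \<le> T" for t
      using B[OF that] u_pos[OF that] \<open>v T > 0\<close> M_ge_1 by linarith
  qed
qed

end

section \<open>The symmetric periodic orbit\<close>

context competition
begin

lemma flow_components:
  assumes Y: "\<And>t. (Y has_vector_derivative field (Y t)) (at t)"
  shows "((\<lambda>t. fst (Y t)) has_real_derivative fst (snd (snd (Y t)))) (at t)"
    "((\<lambda>t. fst (snd (Y t))) has_real_derivative snd (snd (snd (Y t)))) (at t)"
    "((\<lambda>t. fst (snd (snd (Y t)))) has_real_derivative force \<alpha> (fst (Y t)) (fst (snd (Y t)))) (at t)"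
    "((\<lambda>t. snd (snd (snd (Y t)))) has_real_derivative force \<gamma> (fst (snd (Y t))) (fst (Y t))) (at t)"
proof -
  have fst: "((\<lambda>t. fst (Z t)) has_vector_derivative fst z) (at t)"
    and snd: "((\<lambda>t. snd (Z t)) has_vector_derivative snd z) (at t)"
    if "(Z has_vector_derivative z) (at t)"
    for Z :: "real \<Rightarrow> 'x::real_normed_vector \<times> 'y::real_normed_vector" and z t
    using bounded_linear.has_vector_derivative[OF bounded_linear_fst that]
      bounded_linear.has_vector_derivative[OF bounded_linear_snd that] by auto
  have parts: "field (Y t) = (fst (snd (snd (Y t))), snd (snd (snd (Y t))),
      force \<alpha> (fst (Y t)) (fst (snd (Y t))), force \<gamma> (fst (snd (Y t))) (fst (Y t)))" for t
    by (cases "Y t") (simp add: field_def)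
  show "((\<lambda>t. fst (Y t)) has_real_derivative fst (snd (snd (Y t)))) (at t)"
    "((\<lambda>t. fst (snd (Y t))) has_real_derivative snd (snd (snd (Y t)))) (at t)"
    "((\<lambda>t. fst (snd (snd (Y t)))) has_real_derivative force \<alpha> (fst (Y t)) (fst (snd (Y t)))) (at t)"
    "((\<lambda>t. snd (snd (snd (Y t)))) has_real_derivative force \<gamma> (fst (snd (Y t))) (fst (Y t))) (at t)"
    using fst[OF Y] fst[OF snd[OF Y]] fst[OF snd[OF snd[OF Y]]] snd[OF snd[OF snd[OF Y]]]
    unfolding has_real_derivative_iff_has_vector_derivative by (simp_all add: parts)
qed

lemma trajectory_of_flow:
  assumes Y: "\<And>t. (Y has_vector_derivative field (Y t)) (at t)" and Y0: "Y 0 = (\<sigma>, 1, 0, 0)"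
    and \<sigma>: "0 \<le> \<sigma>" "\<sigma>\<^sup>2 \<le> \<gamma> / \<beta>"
  shows "trajectory \<alpha> \<beta> \<gamma> \<sigma> (\<lambda>t. fst (Y t)) (\<lambda>t. fst (snd (Y t)))
           (\<lambda>t. fst (snd (snd (Y t)))) (\<lambda>t. snd (snd (snd (Y t))))"
  by unfold_locales (simp_all add: Y0 \<sigma> flow_components[OF Y])

text \<open>
  The two alternatives are disjoint and relatively open in the connected parameter interval, and each
  contains one of its end points, so they do not exhaust it.
\<close>
lemma exists_rest_to_rest_orbit:
  "\<exists>Y T. T > 0 \<and> (\<forall>t. (Y has_vector_derivative field (Y t)) (at t)) \<and>
     snd (snd (Y 0)) = 0 \<and> snd (snd (Y T)) = 0 \<and>
     (\<forall>t. 0 \<le> t \<longrightarrow> t \<le> T \<longrightarrow>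
       0 < fst (Y t) \<and> fst (Y t) \<le> M \<and> 0 < fst (snd (Y t)) \<and> fst (snd (Y t)) \<le> M)"
proof -
  obtain L where "L > 0" and L: "\<And>Y Z. norm (field Y - field Z) \<le> L * norm (Y - Z)"
    using field_lipschitz by blast
  have "\<exists>y. y 0 = (\<sigma>, 1, 0, 0) \<and> (\<forall>t. (y has_vector_derivative field (y t)) (at t))" for \<sigma>
    by (rule lipschitz_ode_global_solution[OF \<open>L > 0\<close> L])
  then obtain Y where Y0: "\<And>\<sigma>. Y \<sigma> 0 = (\<sigma>, 1, 0, 0)"
    and Y: "\<And>\<sigma> t. (Y \<sigma> has_vector_derivative field (Y \<sigma> t)) (at t)"
    by metis
  have cont: "continuous_on UNIV (Y \<sigma>)" for \<sigma>
    by (intro continuous_at_imp_continuous_on ballI has_vector_derivative_continuous[OF Y])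
  have dep: "norm (Y \<sigma> t - Y \<sigma>' t) \<le> exp (L * \<bar>t\<bar>) * \<bar>\<sigma> - \<sigma>'\<bar>" for \<sigma> \<sigma>' t
    using lipschitz_ode_dependence[OF L Y Y, of \<sigma> t \<sigma>'] by (simp add: Y0 norm_Pair)
  define u v p q where "u = (\<lambda>\<sigma> t. fst (Y \<sigma> t))" and "v = (\<lambda>\<sigma> t. fst (snd (Y \<sigma> t)))"
    and "p = (\<lambda>\<sigma> t. fst (snd (snd (Y \<sigma> t))))" and "q = (\<lambda>\<sigma> t. snd (snd (snd (Y \<sigma> t))))"
  define s1 where "s1 = sqrt (\<gamma> / \<beta>)"
  have s1: "s1 > 0" "s1\<^sup>2 = \<gamma> / \<beta>" using pos by (auto simp: s1_def)
  have traj: "trajectory \<alpha> \<beta> \<gamma> \<sigma> (u \<sigma>) (v \<sigma>) (p \<sigma>) (q \<sigma>)" if "0 \<le> \<sigma>" "\<sigma> \<le> s1" for \<sigma>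
    unfolding u_def v_def p_def q_def
    using that s1 power_mono[OF that(2,1), of 2] by (intro trajectory_of_flow Y Y0) auto
  define A where "A = {\<sigma>. \<exists>t\<ge>0. Y \<sigma> t \<in> {Z. snd (snd (snd Z)) > 0} \<and>
    (\<forall>\<tau>\<in>{0..t}. Y \<sigma> \<tau> \<in> {Z. fst (snd (snd Z)) > 0 \<or> force \<alpha> (fst Z) (fst (snd Z)) > 0})}"
  define C where "C = {\<sigma>. \<exists>t\<ge>0. Y \<sigma> t \<in> {Z. fst (snd (snd Z)) < 0 \<or> fst (snd Z) < 0} \<and>
    (\<forall>\<tau>\<in>{0..t}. Y \<sigma> \<tau> \<in> {Z. snd (snd (snd Z)) < 0 \<or> force \<gamma> (fst (snd Z)) (fst Z) < 0})}"
  have "open A"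
    unfolding A_def
    by (intro open_hit_before_exit[OF cont dep \<open>L > 0\<close>] open_Collect_disj open_Collect_less continuous_intros)
  have "open C"
    unfolding C_def
    by (intro open_hit_before_exit[OF cont dep \<open>L > 0\<close>] open_Collect_disj open_Collect_less continuous_intros)
  have A_iff: "\<sigma> \<in> A \<longleftrightarrow> trajectory.v_turns_first \<alpha> \<beta> (u \<sigma>) (v \<sigma>) (p \<sigma>) (q \<sigma>)"
    and C_iff: "\<sigma> \<in> C \<longleftrightarrow> trajectory.u_turns_first \<alpha> \<beta> \<gamma> (u \<sigma>) (v \<sigma>) (p \<sigma>) (q \<sigma>)"
    if "0 \<le> \<sigma>" "\<sigma> \<le> s1" for \<sigma>
    unfolding trajectory.v_turns_first_def[OF traj[OF that]] trajectory.u_turns_first_def[OF traj[OF that]]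
    by (simp_all add: A_def C_def u_def v_def p_def q_def)
  have "0 \<in> C"
    using trajectory.u_turns_first_if_u_absent[OF traj[of 0]] C_iff[of 0] s1 by simp
  have "s1 \<in> A"
    using trajectory.v_turns_first_if_v_balanced[OF traj[of s1]] A_iff[of s1] s1 by simp
  have disjoint: "A \<inter> C \<inter> {0..s1} = {}"
    using trajectory.not_both_turn_first[OF traj] A_iff C_iff by auto
  have "\<not> {0..s1} \<subseteq> A \<union> C"
  proof
    assume "{0..s1} \<subseteq> A \<union> C"
    from connectedD[OF connected_Icc \<open>open A\<close> \<open>open C\<close> disjoint this]
    show False using \<open>0 \<in> C\<close> \<open>s1 \<in> A\<close> s1 by auto
  qed
  then obtain \<sigma> where \<sigma>: "0 \<le> \<sigma>" "\<sigma> \<le> s1" "\<sigma> \<notin> A" "\<sigma> \<notin> C" by force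
  have "0 < \<sigma>" using \<sigma> \<open>0 \<in> C\<close> by (cases "\<sigma> = 0") auto
  have "\<sigma> < s1" using \<sigma> \<open>s1 \<in> A\<close> by (cases "\<sigma> = s1") auto
  then have "\<sigma>\<^sup>2 < \<gamma> / \<beta>"
    using \<sigma> s1(2) power_strict_mono[of \<sigma> s1 2] by simp
  moreover have "\<not> trajectory.v_turns_first \<alpha> \<beta> (u \<sigma>) (v \<sigma>) (p \<sigma>) (q \<sigma>)"
    "\<not> trajectory.u_turns_first \<alpha> \<beta> \<gamma> (u \<sigma>) (v \<sigma>) (p \<sigma>) (q \<sigma>)"
    using \<sigma> A_iff C_iff by auto
  ultimately obtain T where T: "T > 0" "p \<sigma> T = 0" "q \<sigma> T = 0"
    "\<And>t. 0 \<le> t \<Longrightarrow> t \<le> T \<Longrightarrow> 0 < u \<sigma> t \<and> u \<sigma> t \<le> M \<and> 0 < v \<sigma> t \<and> v \<sigma> t \<le> M"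
    using trajectory.simultaneous_rest[OF traj[OF \<sigma>(1,2)] \<open>0 < \<sigma>\<close>] by metis
  have "snd (snd (Y \<sigma> 0)) = 0" by (simp add: Y0 zero_prod_def)
  moreover have "snd (snd (Y \<sigma> T)) = 0" using T by (simp add: p_def q_def prod_eq_iff)
  ultimately show ?thesis
    using T(1,4) Y unfolding u_def v_def by (intro exI[of _ "Y \<sigma>"] exI[of _ T]) simp
qed

text \<open>
  If (u, v, p, q)(a + s) is a solution, then so is (u, v, -p, -q)(a - s), and at s = 0 the two
  agree because the velocities vanish.
\<close>
lemma reflection_about_rest_point:
  assumes Y: "\<And>t. (Y has_vector_derivative field (Y t)) (at t)" and rest: "snd (snd (Y a)) = 0"
  shows "fst (Y (a + s)) = fst (Y (a - s))" "fst (snd (Y (a + s))) = fst (snd (Y (a - s)))"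
proof -
  obtain L where "L > 0" and L: "\<And>Y Z. norm (field Y - field Z) \<le> L * norm (Y - Z)"
    using field_lipschitz by blast
  define R :: "real \<times> real \<times> real \<times> real \<Rightarrow> real \<times> real \<times> real \<times> real"
    where "R = (\<lambda>Z. (fst Z, fst (snd Z), - snd (snd Z)))"
  have R: "bounded_linear R"
    unfolding R_def
    by (intro bounded_linear_Pair bounded_linear_minus bounded_linear_fst
        bounded_linear_compose[OF bounded_linear_fst] bounded_linear_compose[OF bounded_linear_snd]
        bounded_linear_snd)
  have RF: "R (- field Z) = field (R Z)" for Z
    by (cases Z) (simp add: R_def field_def)
  have bwd: "((\<lambda>s. Y (a - s)) has_vector_derivative - field (Y (a - s))) (at s)" for s
    by (rule has_vector_derivative_reflect[OF Y])
  have fwd: "((\<lambda>s. Y (a + s)) has_vector_derivative field (Y (a + s))) (at s)" for s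
    using has_vector_derivative_reflect[OF bwd[of "0 - s"]] by simp
  have "((\<lambda>s. R (Y (a - s))) has_vector_derivative field (R (Y (a - s)))) (at s)" for s
    using bounded_linear.has_vector_derivative[OF R bwd[of s]] by (simp add: RF)
  from lipschitz_ode_dependence[OF L fwd this, of s]
  have "norm (Y (a + s) - R (Y (a - s))) \<le> exp (L * \<bar>s\<bar>) * norm (Y a - R (Y a))"
    by simp
  moreover have "R (Y a) = Y a"
    using rest by (simp add: R_def prod_eq_iff)
  ultimately have "Y (a + s) = R (Y (a - s))" by simp
  then show "fst (Y (a + s)) = fst (Y (a - s))" "fst (snd (Y (a + s))) = fst (snd (Y (a - s)))"
    by (simp_all add: R_def)
qed

text \<open>
  The reflections of time about 0 and about T carry every time into [0, T], where both components are
  positive and the truncation is inactive.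
\<close>
theorem exists_positive_entire_orbit:
  "\<exists>u v p q :: real \<Rightarrow> real.
     (\<forall>t. (u has_real_derivative p t) (at t)) \<and> (\<forall>t. (v has_real_derivative q t) (at t)) \<and>
     (\<forall>t. (p has_real_derivative u t * (\<beta> * (v t)\<^sup>2 - \<alpha> * (u t)\<^sup>2)) (at t)) \<and>
     (\<forall>t. (q has_real_derivative v t * (\<beta> * (u t)\<^sup>2 - \<gamma> * (v t)\<^sup>2)) (at t)) \<and>
     (\<forall>t. u t > 0) \<and> (\<forall>t. v t > 0)"
proof -
  obtain Y T where "T > 0" and flow: "\<forall>t. (Y has_vector_derivative field (Y t)) (at t)"
    and rest: "snd (snd (Y 0)) = 0" "snd (snd (Y T)) = 0"
    and range: "\<forall>t. 0 \<le> t \<longrightarrow> t \<le> T \<longrightarrow>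
       0 < fst (Y t) \<and> fst (Y t) \<le> M \<and> 0 < fst (snd (Y t)) \<and> fst (snd (Y t)) \<le> M"
    using exists_rest_to_rest_orbit by (elim exE conjE) (rule that)
  note Y = flow[rule_format]
  define u v where "u = (\<lambda>t. fst (Y t))" and "v = (\<lambda>t. fst (snd (Y t)))"
  define P where "P = (\<lambda>t. 0 < u t \<and> u t \<le> M \<and> 0 < v t \<and> v t \<le> M)"
  have even: "P (- t) \<longleftrightarrow> P t" for t
    using reflection_about_rest_point[OF Y rest(1), of t] by (simp add: P_def u_def v_def)
  have refl: "P (2 * T - t) \<longleftrightarrow> P t" for t
    using reflection_about_rest_point[OF Y rest(2), of "t - T"] by (simp add: P_def u_def v_def)
  have base: "P t" if "\<bar>t\<bar> \<le> T" for t
  proof -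
    have "P \<bar>t\<bar>" using range[rule_format, of "\<bar>t\<bar>"] that by (simp add: P_def u_def v_def)
    then show ?thesis using even[of t] by (cases "t \<ge> 0") auto
  qed
  have all: "P t" if "\<bar>t\<bar> \<le> (2 * real n + 1) * T" for n t
    using that
  proof (induction n arbitrary: t)
    case 0
    then show ?case by (intro base) simp
  next
    case (Suc n)
    show ?case
    proof (cases "\<bar>t\<bar> \<le> T")
      case True
      then show ?thesis by (rule base)
    next
      case False
      have "\<bar>t\<bar> - 2 * T \<le> (2 * real n + 1) * T" using Suc.prems by (simp add: algebra_simps)
      moreover have "T \<le> (2 * real n + 1) * T" using \<open>T > 0\<close> by simp
      ultimately have "\<bar>2 * T - \<bar>t\<bar>\<bar> \<le> (2 * real n + 1) * T"
        using False by linarith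
      then have "P (2 * T - \<bar>t\<bar>)" by (rule Suc.IH)
      then have "P \<bar>t\<bar>" by (simp only: refl)
      then show ?thesis using even[of t] by (cases "t \<ge> 0") auto
    qed
  qed
  have P: "P t" for t
  proof -
    obtain n :: nat where "\<bar>t\<bar> / T \<le> real n" using real_arch_simple by blast
    then have "\<bar>t\<bar> \<le> real n * T" using \<open>T > 0\<close> by (simp add: field_simps)
    also have "\<dots> \<le> (2 * real n + 1) * T" using \<open>T > 0\<close> by simp
    finally show ?thesis by (rule all)
  qed
  have clamp: "clamp (u t) = u t" "clamp (v t) = v t" for t
    using P[of t] by (auto simp: P_def clamp_id)
  show ?thesis
  proof (intro exI conjI allI)
    fix t
    show "(u has_real_derivative fst (snd (snd (Y t)))) (at t)"
      "(v has_real_derivative snd (snd (snd (Y t)))) (at t)"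
      unfolding u_def v_def by (rule flow_components[OF Y])+
    show "((\<lambda>t. fst (snd (snd (Y t)))) has_real_derivative
        u t * (\<beta> * (v t)\<^sup>2 - \<alpha> * (u t)\<^sup>2)) (at t)"
      using flow_components(3)[OF Y, of t] clamp[of t] by (simp add: force_def u_def v_def)
    show "((\<lambda>t. snd (snd (snd (Y t)))) has_real_derivative
        v t * (\<beta> * (u t)\<^sup>2 - \<gamma> * (v t)\<^sup>2)) (at t)"
      using flow_components(4)[OF Y, of t] clamp[of t] by (simp add: force_def u_def v_def)
    show "u t > 0" "v t > 0" using P[of t] by (simp_all add: P_def)
  qed
qed

end

section \<open>Partial derivatives of simple functions\<close>

lemma partial_deriv_of_coordinate_function:
  fixes g g' :: "real \<Rightarrow> real"
  assumes "\<And>t. (g has_real_derivative g' t) (at t)"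
  shows "(\<lambda>x :: real ^ 'n::finite. g (x $ k)) differentiable (at x)"
    "partial_deriv j (\<lambda>x :: real ^ 'n. g (x $ k)) = (\<lambda>x. if j = k then g' (x $ k) else 0)"
proof -
  have d: "((\<lambda>x :: real ^ 'n. g (x $ k)) has_derivative (\<lambda>h. g' (x $ k) * h $ k)) (at x)" for x
  proof -
    have "((\<lambda>x :: real ^ 'n. x $ k) has_derivative (\<lambda>h. h $ k)) (at x)"
      by (rule bounded_linear_imp_has_derivative) (rule bounded_linear_vec_nth)
    from has_derivative_compose[OF this, of g "(*) (g' (x $ k))"] show ?thesis
      using assms[of "x $ k"] by (simp add: has_field_derivative_def)
  qed
  then show "(\<lambda>x :: real ^ 'n. g (x $ k)) differentiable (at x)"
    unfolding differentiable_def by blast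
  show "partial_deriv j (\<lambda>x :: real ^ 'n. g (x $ k)) = (\<lambda>x. if j = k then g' (x $ k) else 0)"
    unfolding partial_deriv_def frechet_derivative_at[OF d, symmetric]
    by (auto simp: axis_def)
qed

lemma coordinate_function_C2:
  fixes g g' g'' :: "real \<Rightarrow> real"
  assumes g: "\<And>t. (g has_real_derivative g' t) (at t)"
    and g': "\<And>t. (g' has_real_derivative g'' t) (at t)"
    and g'': "continuous_on UNIV g''"
  shows "C2_function (\<lambda>x :: real ^ 'n::finite. g (x $ k))"
    "laplacian (\<lambda>x :: real ^ 'n. g (x $ k)) x = g'' (x $ k)"
proof -
  have zero: "((\<lambda>t. 0 :: real) has_real_derivative 0) (at t)" for t by simp
  have cont: "continuous_on UNIV (\<lambda>x :: real ^ 'n. h (x $ k))" if "continuous_on UNIV h"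
    for h :: "real \<Rightarrow> real"
    by (rule continuous_on_compose2[OF that]) (auto intro!: continuous_intros)
  have C1: "C1_function (\<lambda>x :: real ^ 'n. h (x $ k))"
    if "\<And>t. (h has_real_derivative h' t) (at t)" "continuous_on UNIV h'" for h h' :: "real \<Rightarrow> real"
  proof -
    have "continuous_on UNIV (\<lambda>x :: real ^ 'n. if j = k then h' (x $ k) else 0)" for j
      using cont[OF that(2)] by (cases "j = k") simp_all
    then show ?thesis
      unfolding C1_function_def partial_deriv_of_coordinate_function(2)[OF that(1)]
      using partial_deriv_of_coordinate_function(1)[OF that(1)] by blast
  qed
  have "continuous_on UNIV g'"
    using g' by (meson DERIV_isCont continuous_at_imp_continuous_on)
  moreover have "C1_function (\<lambda>x :: real ^ 'n. if j = k then g' (x $ k) else 0)" for j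
    using C1[OF g' g''] C1[OF zero] by (cases "j = k") simp_all
  ultimately show "C2_function (\<lambda>x :: real ^ 'n. g (x $ k))"
    unfolding C2_function_def partial_deriv_of_coordinate_function(2)[OF g]
    using C1[OF g] by blast
  have second: "partial_deriv j (partial_deriv j (\<lambda>x :: real ^ 'n. g (x $ k)))
      = (\<lambda>x. if j = k then g'' (x $ k) else 0)" for j
    unfolding partial_deriv_of_coordinate_function(2)[OF g]
    using partial_deriv_of_coordinate_function(2)[OF g', of k k]
      partial_deriv_of_coordinate_function(2)[OF zero, of j k]
    by (cases "j = k") auto
  show "laplacian (\<lambda>x :: real ^ 'n. g (x $ k)) x = g'' (x $ k)"
    unfolding laplacian_def second by simp
qed

lemma C2_function_linear_combination:
  fixes f g :: "real ^ 'n::finite \<Rightarrow> real"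
  assumes f: "C2_function f" and g: "C2_function g"
  shows "C2_function (\<lambda>x. a * f x + b * g x)"
    "laplacian (\<lambda>x. a * f x + b * g x) x = a * laplacian f x + b * laplacian g x"
proof -
  have partial: "partial_deriv k (\<lambda>x. a * f x + b * g x)
      = (\<lambda>x. a * partial_deriv k f x + b * partial_deriv k g x)"
    and diff: "(\<lambda>x. a * f x + b * g x) differentiable (at x)"
    if "C1_function f" "C1_function g" for f g :: "real ^ 'n \<Rightarrow> real" and k x
  proof -
    have d: "((\<lambda>x. a * f x + b * g x) has_derivative
        (\<lambda>h. a * frechet_derivative f (at x) h + b * frechet_derivative g (at x) h)) (at x)" for x
      using that frechet_derivative_works
      by (auto intro!: derivative_intros simp: C1_function_def)
    then show "(\<lambda>x. a * f x + b * g x) differentiable (at x)"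
      unfolding differentiable_def by blast
    show "partial_deriv k (\<lambda>x. a * f x + b * g x)
        = (\<lambda>x. a * partial_deriv k f x + b * partial_deriv k g x)"
      unfolding partial_deriv_def frechet_derivative_at[OF d, symmetric] by simp
  qed
  have C1: "C1_function (\<lambda>x. a * f x + b * g x)"
    if "C1_function f" "C1_function g" for f g :: "real ^ 'n \<Rightarrow> real"
    unfolding C1_function_def partial[OF that]
    using that diff[OF that] by (auto intro!: continuous_intros simp: C1_function_def)
  have f1: "C1_function f" "C1_function (partial_deriv k f)"
    and g1: "C1_function g" "C1_function (partial_deriv k g)" for k
    using f g by (auto simp: C2_function_def)
  show "C2_function (\<lambda>x. a * f x + b * g x)"
    unfolding C2_function_def partial[OF f1(1) g1(1)] by (auto intro!: C1 f1 g1)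
  show "laplacian (\<lambda>x. a * f x + b * g x) x = a * laplacian f x + b * laplacian g x"
    unfolding laplacian_def partial[OF f1(1) g1(1)] partial[OF f1(2) g1(2)]
    by (simp add: sum.distrib sum_distrib_left)
qed

section \<open>Copositivity of two by two matrices\<close>

text \<open>
  The condition on the off-diagonal entry results from the vector (sqrt \<beta>22, sqrt \<beta>11), which spans
  the kernel in the borderline case \<beta>12 = -sqrt (\<beta>11 \<beta>22).
\<close>
lemma strictly_copositive_2_iff:
  fixes B :: "real ^ 2 ^ 2"
  assumes sym: "transpose B = B" and nonneg: "B $ 1 $ 1 \<ge> 0" "B $ 2 $ 2 \<ge> 0"
  shows "strictly_copositive B \<longleftrightarrow>
    B $ 1 $ 1 > 0 \<and> B $ 2 $ 2 > 0 \<and> B $ 1 $ 2 > - sqrt (B $ 1 $ 1 * B $ 2 $ 2)"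
proof -
  define \<alpha> \<gamma> b where "\<alpha> = B $ 1 $ 1" and "\<gamma> = B $ 2 $ 2" and "b = B $ 1 $ 2"
  have "B $ 2 $ 1 = b"
    using arg_cong[OF sym, of "\<lambda>A. A $ 1 $ 2"] by (simp add: transpose_def b_def)
  then have form: "(\<Sum>i\<in>UNIV. \<Sum>j\<in>UNIV. B $ i $ j * c $ i * c $ j)
      = \<alpha> * (c $ 1)\<^sup>2 + 2 * b * c $ 1 * c $ 2 + \<gamma> * (c $ 2)\<^sup>2" for c :: "real ^ 2"
    by (simp add: sum_2 \<alpha>_def \<gamma>_def b_def power2_eq_square algebra_simps)
  have "strictly_copositive B \<longleftrightarrow> (\<forall>x y. x \<ge> 0 \<and> y \<ge> 0 \<and> (x \<noteq> 0 \<or> y \<noteq> 0) \<longrightarrow>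
      \<alpha> * x\<^sup>2 + 2 * b * x * y + \<gamma> * y\<^sup>2 > 0)" (is "_ \<longleftrightarrow> ?P")
  proof
    assume cop: "strictly_copositive B"
    show ?P
    proof (intro allI impI)
      fix x y :: real assume xy: "x \<ge> 0 \<and> y \<ge> 0 \<and> (x \<noteq> 0 \<or> y \<noteq> 0)"
      define c :: "real ^ 2" where "c = vector [x, y]"
      have c: "c $ 1 = x" "c $ 2 = y" by (simp_all add: c_def)
      have "(\<forall>i. c $ i \<ge> 0) \<and> c \<noteq> 0"
        using xy c by (auto simp: forall_2 vec_eq_iff)
      then have "(\<Sum>i\<in>UNIV. \<Sum>j\<in>UNIV. B $ i $ j * c $ i * c $ j) > 0"
        using cop unfolding strictly_copositive_def by blast
      then show "\<alpha> * x\<^sup>2 + 2 * b * x * y + \<gamma> * y\<^sup>2 > 0"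
        unfolding form c .
    qed
  next
    assume P: ?P
    show "strictly_copositive B"
      unfolding strictly_copositive_def form
    proof (intro allI impI)
      fix c :: "real ^ 2" assume "(\<forall>i. 0 \<le> c $ i) \<and> c \<noteq> 0"
      then have "c $ 1 \<ge> 0 \<and> c $ 2 \<ge> 0 \<and> (c $ 1 \<noteq> 0 \<or> c $ 2 \<noteq> 0)"
        by (auto simp: vec_eq_iff forall_2)
      then show "0 < \<alpha> * (c $ 1)\<^sup>2 + 2 * b * c $ 1 * c $ 2 + \<gamma> * (c $ 2)\<^sup>2"
        using P by blast
    qed
  qed
  also have "\<dots> \<longleftrightarrow> \<alpha> > 0 \<and> \<gamma> > 0 \<and> b > - sqrt (\<alpha> * \<gamma>)"
  proof
    assume P: ?P
    have "\<alpha> > 0" using P[rule_format, of 1 0] by simp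
    have "\<gamma> > 0" using P[rule_format, of 0 1] by simp
    define r where "r = sqrt (\<alpha> * \<gamma>)"
    have r: "r > 0" "r = sqrt \<gamma> * sqrt \<alpha>" "r\<^sup>2 = \<alpha> * \<gamma>"
      using \<open>\<alpha> > 0\<close> \<open>\<gamma> > 0\<close> by (simp_all add: r_def real_sqrt_mult power_mult_distrib)
    have "0 < \<alpha> * (sqrt \<gamma>)\<^sup>2 + 2 * b * sqrt \<gamma> * sqrt \<alpha> + \<gamma> * (sqrt \<alpha>)\<^sup>2"
      using P[rule_format, of "sqrt \<gamma>" "sqrt \<alpha>"] \<open>\<alpha> > 0\<close> \<open>\<gamma> > 0\<close> by simp
    also have "\<dots> = 2 * r * (r + b)"
      using \<open>\<alpha> > 0\<close> \<open>\<gamma> > 0\<close> r(2,3) by (simp add: algebra_simps power2_eq_square)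
    finally have "r + b > 0" using r(1) by (simp add: zero_less_mult_iff)
    then show "\<alpha> > 0 \<and> \<gamma> > 0 \<and> b > - sqrt (\<alpha> * \<gamma>)"
      using \<open>\<alpha> > 0\<close> \<open>\<gamma> > 0\<close> unfolding r_def by linarith
  next
    assume A: "\<alpha> > 0 \<and> \<gamma> > 0 \<and> b > - sqrt (\<alpha> * \<gamma>)"
    show ?P
    proof (intro allI impI)
      fix x y :: real assume xy: "x \<ge> 0 \<and> y \<ge> 0 \<and> (x \<noteq> 0 \<or> y \<noteq> 0)"
      show "\<alpha> * x\<^sup>2 + 2 * b * x * y + \<gamma> * y\<^sup>2 > 0"
      proof (cases "x = 0 \<or> y = 0")
        case True
        then show ?thesis using xy A by auto
      next
        case False
        then have "x * y > 0" using xy by simp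
        have "0 \<le> (sqrt \<alpha> * x - sqrt \<gamma> * y)\<^sup>2" by simp
        also have "\<dots> = (sqrt \<alpha>)\<^sup>2 * x\<^sup>2 - 2 * (sqrt \<alpha> * sqrt \<gamma>) * (x * y) + (sqrt \<gamma>)\<^sup>2 * y\<^sup>2"
          by (simp add: algebra_simps power2_eq_square)
        also have "\<dots> = \<alpha> * x\<^sup>2 + 2 * (- sqrt (\<alpha> * \<gamma>)) * (x * y) + \<gamma> * y\<^sup>2"
          using A by (simp add: real_sqrt_mult)
        also have "\<dots> < \<alpha> * x\<^sup>2 + 2 * b * (x * y) + \<gamma> * y\<^sup>2"
          using A \<open>x * y > 0\<close> by (intro add_strict_right_mono add_strict_left_mono mult_strict_right_mono) auto
        finally show ?thesis by (simp add: mult.assoc)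
      qed
    qed
  qed
  finally show ?thesis by (simp add: \<alpha>_def \<gamma>_def b_def)
qed

text \<open>
  Let a^4 = \<alpha>, g^4 = \<gamma>, X = a x, Y = g y and b = -\<kappa> a^2 g^2. Then the right-hand side equals
  a g (X + Y) (X^2 + Y^2 - (1 + \<kappa>) X Y), and for 0 \<le> \<kappa> < 1 the quadratic factor is at least
  (1 - \<kappa>)/4 (X + Y)^2. A positive b only increases the right-hand side and is replaced by 0.
\<close>
lemma weighted_cubic_lower_bound:
  fixes \<alpha> \<gamma> b :: real
  assumes "\<alpha> > 0" "\<gamma> > 0" "b > - sqrt (\<alpha> * \<gamma>)"
  obtains a g c where "a > 0" "g > 0" "c > 0"
    "\<And>x y. x \<ge> 0 \<Longrightarrow> y \<ge> 0 \<Longrightarrow>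
       c * (g * x + a * y) ^ 3 \<le> g * (x * (\<alpha> * x\<^sup>2 + b * y\<^sup>2)) + a * (y * (b * x\<^sup>2 + \<gamma> * y\<^sup>2))"
proof -
  define a g where "a = sqrt (sqrt \<alpha>)" and "g = sqrt (sqrt \<gamma>)"
  have ag: "a > 0" "g > 0" using assms by (auto simp: a_def g_def)
  have a4: "a\<^sup>2 = sqrt \<alpha>" "g\<^sup>2 = sqrt \<gamma>" "a ^ 4 = \<alpha>" "g ^ 4 = \<gamma>"
    using assms power_mult[of a 2 2] power_mult[of g 2 2] by (auto simp: a_def g_def)
  define \<kappa> where "\<kappa> = - min b 0 / (a\<^sup>2 * g\<^sup>2)"
  define s where "s = a\<^sup>2 * g\<^sup>2"
  have "s > 0" "b > - s" using assms ag a4 by (auto simp: s_def real_sqrt_mult)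
  then have \<kappa>: "0 \<le> \<kappa>" "\<kappa> < 1" "- \<kappa> * (a\<^sup>2 * g\<^sup>2) \<le> b"
    unfolding \<kappa>_def s_def[symmetric] by (auto simp: min_def divide_le_0_iff less_divide_eq)
  define \<epsilon> where "\<epsilon> = (1 - \<kappa>) / 4"
  define Q where "Q = g / a + a / g"
  have "Q > 0" "\<epsilon> > 0" using ag \<kappa> by (auto simp: Q_def \<epsilon>_def intro: add_pos_pos)
  define c where "c = a * g * \<epsilon> / Q ^ 3"
  have bound: "c * (g * x + a * y) ^ 3
      \<le> g * (x * (\<alpha> * x\<^sup>2 + b * y\<^sup>2)) + a * (y * (b * x\<^sup>2 + \<gamma> * y\<^sup>2))" if xy: "x \<ge> 0" "y \<ge> 0" for x y
  proof -
    define X Y where "X = a * x" and "Y = g * y"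
    have XY: "X \<ge> 0" "Y \<ge> 0" using xy ag by (auto simp: X_def Y_def)
    have "g * x + a * y = (g / a) * X + (a / g) * Y"
      using ag by (simp add: X_def Y_def)
    also have "\<dots> \<le> Q * X + Q * Y"
      using XY ag by (intro add_mono mult_right_mono) (auto simp: Q_def)
    finally have "(g * x + a * y) ^ 3 \<le> (Q * (X + Y)) ^ 3"
      using xy ag by (intro power_mono) (auto simp: algebra_simps)
    then have "c * (g * x + a * y) ^ 3 \<le> c * (Q * (X + Y)) ^ 3"
      using \<open>Q > 0\<close> \<open>\<epsilon> > 0\<close> ag by (intro mult_left_mono) (auto simp: c_def)
    also have "\<dots> = a * g * (X + Y) * (\<epsilon> * (X + Y)\<^sup>2)"
      using \<open>Q > 0\<close> by (simp add: c_def power_mult_distrib power3_eq_cube power2_eq_square)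
    also have "\<epsilon> * (X + Y)\<^sup>2 = X\<^sup>2 + Y\<^sup>2 - (1 + \<kappa>) * X * Y - (3 + \<kappa>) / 4 * (X - Y)\<^sup>2"
      by (simp add: \<epsilon>_def power2_eq_square field_simps)
    also have "a * g * (X + Y) * \<dots> \<le> a * g * (X + Y) * (X\<^sup>2 + Y\<^sup>2 - (1 + \<kappa>) * X * Y)"
      using XY ag \<kappa> by (intro mult_left_mono) auto
    also have "\<dots> = g * (x * (a ^ 4 * x\<^sup>2 + - \<kappa> * (a\<^sup>2 * g\<^sup>2) * y\<^sup>2))
        + a * (y * (- \<kappa> * (a\<^sup>2 * g\<^sup>2) * x\<^sup>2 + g ^ 4 * y\<^sup>2))"
      by (simp add: X_def Y_def power2_eq_square power4_eq_xxxx algebra_simps)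
    also have "\<dots> \<le> g * (x * (\<alpha> * x\<^sup>2 + b * y\<^sup>2)) + a * (y * (b * x\<^sup>2 + \<gamma> * y\<^sup>2))"
      using xy ag \<kappa>(3) unfolding a4(3,4)
      by (intro add_mono mult_left_mono mult_right_mono order_refl) auto
    finally show ?thesis .
  qed
  have "c > 0" using ag \<open>Q > 0\<close> \<open>\<epsilon> > 0\<close> by (simp add: c_def)
  then show ?thesis using that ag bound by blast
qed

section \<open>Solutions of the elliptic system\<close>

lemma solution_2_iff:
  fixes B :: "real ^ 2 ^ 2" and u :: "2 \<Rightarrow> real ^ 'n::finite \<Rightarrow> real"
  shows "nonneg_entire_solution B u \<longleftrightarrow>
    C2_function (u 1) \<and> C2_function (u 2) \<and> (\<forall>x. u 1 x \<ge> 0) \<and> (\<forall>x. u 2 x \<ge> 0) \<and>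
    (\<forall>x. - laplacian (u 1) x = u 1 x * (B $ 1 $ 1 * (u 1 x)\<^sup>2 + B $ 1 $ 2 * (u 2 x)\<^sup>2)) \<and>
    (\<forall>x. - laplacian (u 2) x = u 2 x * (B $ 2 $ 1 * (u 1 x)\<^sup>2 + B $ 2 $ 2 * (u 2 x)\<^sup>2))"
  unfolding nonneg_entire_solution_def by (auto simp: forall_2 sum_2 algebra_simps)

lemma nontrivial_2_iff:
  fixes u :: "2 \<Rightarrow> real ^ 'n::finite \<Rightarrow> real"
  shows "nontrivial u \<longleftrightarrow> (\<exists>x. u 1 x \<noteq> 0) \<or> (\<exists>x. u 2 x \<noteq> 0)"
  unfolding nontrivial_def fun_eq_iff by (metis exhaust_2)

lemma entire_solution_from_ode:
  fixes B :: "real ^ 2 ^ 2" and u v p q :: "real \<Rightarrow> real"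
  assumes u: "\<And>t. (u has_real_derivative p t) (at t)"
    and v: "\<And>t. (v has_real_derivative q t) (at t)"
    and p: "\<And>t. (p has_real_derivative - (u t * (B $ 1 $ 1 * (u t)\<^sup>2 + B $ 1 $ 2 * (v t)\<^sup>2))) (at t)"
    and q: "\<And>t. (q has_real_derivative - (v t * (B $ 2 $ 1 * (u t)\<^sup>2 + B $ 2 $ 2 * (v t)\<^sup>2))) (at t)"
    and nonneg: "\<And>t. u t \<ge> 0" "\<And>t. v t \<ge> 0" and nonzero: "u 0 \<noteq> 0 \<or> v 0 \<noteq> 0"
  shows "\<exists>w :: 2 \<Rightarrow> real ^ 'n::finite \<Rightarrow> real. nonneg_entire_solution B w \<and> nontrivial w"
proof -
  fix k :: 'n
  have "continuous_on UNIV u" "continuous_on UNIV v"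
    using u v by (meson DERIV_isCont continuous_at_imp_continuous_on)+
  then have cont: "continuous_on UNIV (\<lambda>t. - (u t * (B $ 1 $ 1 * (u t)\<^sup>2 + B $ 1 $ 2 * (v t)\<^sup>2)))"
    "continuous_on UNIV (\<lambda>t. - (v t * (B $ 2 $ 1 * (u t)\<^sup>2 + B $ 2 $ 2 * (v t)\<^sup>2)))"
    by (auto intro!: continuous_intros)
  define w :: "2 \<Rightarrow> real ^ 'n \<Rightarrow> real"
    where "w = (\<lambda>i x. if i = 1 then u (x $ k) else v (x $ k))"
  have w: "w 1 = (\<lambda>x. u (x $ k))" "w 2 = (\<lambda>x. v (x $ k))" by (auto simp: w_def)
  have "nonneg_entire_solution B w"
    unfolding solution_2_iff w
    using coordinate_function_C2[OF u p cont(1), of k] coordinate_function_C2[OF v q cont(2), of k] nonneg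
    by simp
  moreover have "w 1 0 \<noteq> 0 \<or> w 2 0 \<noteq> 0" using nonzero by (simp add: w)
  then have "nontrivial w" unfolding nontrivial_2_iff by blast
  ultimately show ?thesis by blast
qed

lemma entire_solution_exists_if_not_copositive:
  fixes B :: "real ^ 2 ^ 2"
  assumes sym: "B $ 2 $ 1 = B $ 1 $ 2" and nonneg: "B $ 1 $ 1 \<ge> 0" "B $ 2 $ 2 \<ge> 0"
    and fails: "B $ 1 $ 1 = 0 \<or> B $ 2 $ 2 = 0 \<or> B $ 1 $ 2 \<le> - sqrt (B $ 1 $ 1 * B $ 2 $ 2)"
  shows "\<exists>w :: 2 \<Rightarrow> real ^ 'n::finite \<Rightarrow> real. nonneg_entire_solution B w \<and> nontrivial w"
proof -
  have const_sol: ?thesis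
    if "c \<ge> 0" "d \<ge> 0" "c \<noteq> 0 \<or> d \<noteq> 0" "c * (B $ 1 $ 1 * c\<^sup>2 + B $ 1 $ 2 * d\<^sup>2) = 0"
      "d * (B $ 1 $ 2 * c\<^sup>2 + B $ 2 $ 2 * d\<^sup>2) = 0" for c d :: real
    by (rule entire_solution_from_ode[of "\<lambda>_. c" "\<lambda>_. 0" "\<lambda>_. d" "\<lambda>_. 0"])
      (use that sym in auto)
  define \<alpha> \<gamma> b where "\<alpha> = B $ 1 $ 1" and "\<gamma> = B $ 2 $ 2" and "b = B $ 1 $ 2"
  consider "\<alpha> = 0" | "\<gamma> = 0" | "\<alpha> > 0" "\<gamma> > 0" "b = - sqrt (\<alpha> * \<gamma>)"
    | "\<alpha> > 0" "\<gamma> > 0" "b < - sqrt (\<alpha> * \<gamma>)"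
    using nonneg fails unfolding \<alpha>_def \<gamma>_def b_def by linarith
  then show ?thesis
  proof cases
    case 1
    then show ?thesis using const_sol[of 1 0] by (simp add: \<alpha>_def)
  next
    case 2
    then show ?thesis using const_sol[of 0 1] by (simp add: \<gamma>_def)
  next
    case 3
    show ?thesis
    proof (rule const_sol[of "sqrt (sqrt \<gamma>)" "sqrt (sqrt \<alpha>)"])
      have "\<alpha> * sqrt \<gamma> = sqrt (\<alpha> * \<gamma>) * sqrt \<alpha>" "\<gamma> * sqrt \<alpha> = sqrt (\<alpha> * \<gamma>) * sqrt \<gamma>"
        using 3 by (simp_all add: real_sqrt_mult)
      then show "sqrt (sqrt \<gamma>) * (B $ 1 $ 1 * (sqrt (sqrt \<gamma>))\<^sup>2 + B $ 1 $ 2 * (sqrt (sqrt \<alpha>))\<^sup>2) = 0"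
        "sqrt (sqrt \<alpha>) * (B $ 1 $ 2 * (sqrt (sqrt \<gamma>))\<^sup>2 + B $ 2 $ 2 * (sqrt (sqrt \<alpha>))\<^sup>2) = 0"
        using 3 by (simp_all flip: \<alpha>_def \<gamma>_def b_def)
    qed (use 3 in auto)
  next
    case 4
    have r: "0 < sqrt (\<alpha> * \<gamma>)" "\<alpha> * \<gamma> = (sqrt (\<alpha> * \<gamma>))\<^sup>2" using 4 by simp_all
    then have "\<alpha> * \<gamma> < (- b)\<^sup>2"
      using 4 power_strict_mono[of "sqrt (\<alpha> * \<gamma>)" "- b" 2] by simp
    moreover have "b < 0" using 4 r(1) by linarith
    ultimately interpret competition \<alpha> "- b" \<gamma>
      using 4 by unfold_locales auto
    obtain u v p q :: "real \<Rightarrow> real" where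
      ode: "\<forall>t. (u has_real_derivative p t) (at t)" "\<forall>t. (v has_real_derivative q t) (at t)"
      "\<forall>t. (p has_real_derivative u t * (- b * (v t)\<^sup>2 - \<alpha> * (u t)\<^sup>2)) (at t)"
      "\<forall>t. (q has_real_derivative v t * (- b * (u t)\<^sup>2 - \<gamma> * (v t)\<^sup>2)) (at t)"
      and pos: "\<forall>t. u t > 0" "\<forall>t. v t > 0"
      using exists_positive_entire_orbit by (elim exE conjE) (rule that)
    show ?thesis
    proof (rule entire_solution_from_ode)
      show "(u has_real_derivative p t) (at t)" "(v has_real_derivative q t) (at t)" for t
        using ode by blast+
      show "(p has_real_derivative - (u t * (B $ 1 $ 1 * (u t)\<^sup>2 + B $ 1 $ 2 * (v t)\<^sup>2))) (at t)" for t
        by (rule DERIV_cong[OF ode(3)[rule_format]]) (simp add: algebra_simps flip: \<alpha>_def b_def)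
      show "(q has_real_derivative - (v t * (B $ 2 $ 1 * (u t)\<^sup>2 + B $ 2 $ 2 * (v t)\<^sup>2))) (at t)" for t
        by (rule DERIV_cong[OF ode(4)[rule_format]]) (simp add: sym algebra_simps flip: \<gamma>_def b_def)
      show "u t \<ge> 0" "v t \<ge> 0" for t using pos by (simp_all add: less_imp_le)
      show "u 0 \<noteq> 0 \<or> v 0 \<noteq> 0" using pos by (metis less_irrefl)
    qed
  qed
qed

lemma entire_solution_trivial_if_copositive:
  fixes B :: "real ^ 2 ^ 2" and u :: "2 \<Rightarrow> real ^ 'n::finite \<Rightarrow> real"
  assumes dim: "CARD('n) \<le> 3" and sym: "B $ 2 $ 1 = B $ 1 $ 2"
    and B: "B $ 1 $ 1 > 0" "B $ 2 $ 2 > 0" "B $ 1 $ 2 > - sqrt (B $ 1 $ 1 * B $ 2 $ 2)"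
    and sol: "nonneg_entire_solution B u"
  shows "\<not> nontrivial u"
proof -
  obtain a g c where pos: "a > 0" "g > 0" "c > 0"
    and cubic: "\<And>x y. x \<ge> 0 \<Longrightarrow> y \<ge> 0 \<Longrightarrow> c * (g * x + a * y) ^ 3
      \<le> g * (x * (B $ 1 $ 1 * x\<^sup>2 + B $ 1 $ 2 * y\<^sup>2)) + a * (y * (B $ 1 $ 2 * x\<^sup>2 + B $ 2 $ 2 * y\<^sup>2))"
    using weighted_cubic_lower_bound[OF B] by metis
  have C2: "C2_function (u 1)" "C2_function (u 2)" and nonneg: "\<And>x. u 1 x \<ge> 0" "\<And>x. u 2 x \<ge> 0"
    and eq1: "\<And>x. - laplacian (u 1) x = u 1 x * (B $ 1 $ 1 * (u 1 x)\<^sup>2 + B $ 1 $ 2 * (u 2 x)\<^sup>2)"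
    and eq2: "\<And>x. - laplacian (u 2) x = u 2 x * (B $ 1 $ 2 * (u 1 x)\<^sup>2 + B $ 2 $ 2 * (u 2 x)\<^sup>2)"
    using sol unfolding solution_2_iff sym by auto
  define w where "w = (\<lambda>x. g * u 1 x + a * u 2 x)"
  have "w x = 0" for x
  proof (rule superharmonic_cubic_liouville[OF dim _ _ \<open>c > 0\<close>])
    show "C2_function w" unfolding w_def by (rule C2_function_linear_combination[OF C2])
    show "w x \<ge> 0" for x using nonneg pos by (simp add: w_def)
    show "c * w x ^ 3 \<le> - laplacian w x" for x
    proof -
      have "c * w x ^ 3 \<le> g * (- laplacian (u 1) x) + a * (- laplacian (u 2) x)"
        unfolding w_def eq1 eq2 by (rule cubic[OF nonneg])
      also have "\<dots> = - laplacian w x"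
        unfolding w_def C2_function_linear_combination(2)[OF C2] by simp
      finally show ?thesis .
    qed
  qed
  then have "u 1 x = 0 \<and> u 2 x = 0" for x
    using nonneg[of x] pos by (smt (verit) mult_pos_pos mult_nonneg_nonneg w_def)
  then show ?thesis unfolding nontrivial_2_iff by simp
qed

theorem corollary1p1:
  fixes B :: "real ^ 2 ^ 2"
  assumes "CARD('n::finite) \<in> {1, 2, 3}"
    and "transpose B = B"
    and "B $ 1 $ 1 \<ge> 0" and "B $ 2 $ 2 \<ge> 0"
  shows "((\<exists>u :: 2 \<Rightarrow> real ^ 'n \<Rightarrow> real. nonneg_entire_solution B u \<and> nontrivial u)
            \<longleftrightarrow> \<not> strictly_copositive B)
       \<and> (\<not> strictly_copositive B
            \<longleftrightarrow> \<not> B $ 1 $ 1 > 0 \<or> \<not> B $ 2 $ 2 > 0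
                \<or> \<not> B $ 1 $ 2 > - sqrt (B $ 1 $ 1 * B $ 2 $ 2))"
proof -
  have sym: "B $ 2 $ 1 = B $ 1 $ 2"
    using arg_cong[OF assms(2), of "\<lambda>A. A $ 1 $ 2"] by (simp add: transpose_def)
  have dim: "CARD('n) \<le> 3" using assms(1) by auto
  note cop = strictly_copositive_2_iff[OF assms(2-4)]
  have "\<exists>u :: 2 \<Rightarrow> real ^ 'n \<Rightarrow> real. nonneg_entire_solution B u \<and> nontrivial u"
    if "\<not> strictly_copositive B"
    using that unfolding cop
    by (intro entire_solution_exists_if_not_copositive[OF sym assms(3,4)]) (use assms(3,4) in auto)
  moreover have "\<not> (nonneg_entire_solution B u \<and> nontrivial u)"
    if "strictly_copositive B" for u :: "2 \<Rightarrow> real ^ 'n \<Rightarrow> real"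
    using that entire_solution_trivial_if_copositive[OF dim sym] unfolding cop by blast
  ultimately show ?thesis using cop by blast
qed

end
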